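(* Let $l_0,l_1\in\mathbb{Z}_{\ge0}$, $l_2=l_3=0$ and $m\in\mathbb{Z}_{\ge0}$. Let $v_m(p)$ and $\tilde E_m(p)$ be the eigenvector and the eigenvalue of the Hamiltonian $H$ of the $BC_1$ (one-particle) Inozemtsev model obtained, as formal power series in $p$, by the algorithm of perturbation. If $|p|$ is sufficiently small, then the power series $\tilde E_m(p)$ converges and the power series $v_m(p)$ converges on compact sets of $x$.
   Context: Put $p=\exp(2\pi\sqrt{-1}\tau)$ with $\tau$ in the upper half plane, and let $\wp$ be the Weierstrass function with periods $(1,\tau)$. The Hamiltonian is $H=-\frac{d^2}{dx^2}+l_0(l_0+1)\wp(x)+l_1(l_1+1)\wp(x+\frac12)$. By the expansion $\wp(x)=\frac{\pi^2}{\sin^2\pi x}-\frac{\pi^2}{3}-8\pi^2\sum_{n\ge1}\frac{np^n}{1-p^n}(\cos2n\pi x-1)$ one has $$H=H_T-C_T+\sum_{k=1}^\infty V_k(x)p^k,$$ where $H_T=-\frac{d^2}{dx^2}+l_0(l_0+1)\frac{\pi^2}{\sin^2\pi x}+l_1(l_1+1)\frac{\pi^2}{\cos^2\pi x}$, $C_T=\frac{\pi^2}{3}(l_0(l_0+1)+l_1(l_1+1))$, and each $V_k(x)$ is a finite (real) linear combination of $\cos2\pi nx$ $(n\in\mathbb{Z}_{\ge0})$. Let $v_m=\Phi(x)\psi_m(x)$, where $\Phi(x)=(\sin\pi x)^{l_0+1}(\cos\pi x)^{l_1+1}$ and $\psi_m(x)=\tilde c_m\,{}_2F_1(-m,l_0+l_1+2+m;\frac{2l_0+3}{2};\frac{1-\cos2\pi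 x}{2})$ with $\tilde c_m$ chosen so that $\psi_m(x)=(\cos2\pi x)^m+$ (lower degree terms in $\cos2\pi x$). Then $H_Tv_m=E_mv_m$ with $E_m=\pi^2(l_0+l_1+2+2m)^2$. Let $\langle f,g\rangle=\int_0^1\overline{f(x)}g(x)\,dx$. Algorithm of perturbation: $\tilde E_m(p)=E_m-C_T+\sum_{k\ge1}\tilde E_m^{\{k\}}p^k$ and $v_m(p)=v_m+\sum_{k\ge1}\sum_{m'}c_{m,m'}^{\{k\}}v_{m'}p^k$ (for each $k$ the sum over $m'\in\mathbb{Z}_{\geq 0}$ is finite; coefficients are real and $p$ is treated as a real formal parameter in the inner product) are the formal power series in $p$, determined recursively and uniquely, satisfying $$\Bigl(H_T-C_T+\sum_{k\ge1}V_k(x)p^k\Bigr)v_m(p)=\tilde E_m(p)v_m(p),\qquad \langle v_m(p),v_m(p)\rangle=\langle v_m,v_m\rangle .$$ *)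

theory Defs
  imports "HOL-Analysis.Analysis"
begin

text \<open>
  Throughout, \<open>l0\<close> and \<open>l1\<close> are the coupling parameters (natural numbers) of the one-particle
  \<open>BC\<^sub>1\<close> Inozemtsev model with \<open>l2 = l3 = 0\<close>.
\<close>

subsection \<open>The potential of the Hamiltonian\<close>

text \<open>
  The Weierstrass function with periods \<open>1\<close> and \<open>\<tau>\<close>.
\<close>
definition wp :: "complex \<Rightarrow> complex \<Rightarrow> complex" where
  "wp \<tau> z = 1 / z\<^sup>2 + (\<Sum>\<^sub>\<infinity>(m, n)\<in>UNIV - {(0 :: int, 0 :: int)}.
       1 / (z - of_int m - of_int n * \<tau>)\<^sup>2 - 1 / (of_int m + of_int n * \<tau>)\<^sup>2)"

definition H_potential :: "nat \<Rightarrow> nat \<Rightarrow> complex \<Rightarrow> complex \<Rightarrow> complex" where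
  "H_potential l0 l1 \<tau> z =
     of_nat (l0 * (l0 + 1)) * wp \<tau> z + of_nat (l1 * (l1 + 1)) * wp \<tau> (z + 1 / 2)"

definition HT_potential :: "nat \<Rightarrow> nat \<Rightarrow> real \<Rightarrow> real" where
  "HT_potential l0 l1 x =
     of_nat (l0 * (l0 + 1)) * (pi\<^sup>2 / (sin (pi * x))\<^sup>2) +
     of_nat (l1 * (l1 + 1)) * (pi\<^sup>2 / (cos (pi * x))\<^sup>2)"

definition C_T :: "nat \<Rightarrow> nat \<Rightarrow> real" where
  "C_T l0 l1 = pi\<^sup>2 / 3 * of_nat (l0 * (l0 + 1) + l1 * (l1 + 1))"

text \<open>
  The coefficient of \<open>p\<^sup>k\<close> for \<open>k \<ge> 1\<close> in the potential of \<open>H\<close>; the divisor sum comes from expanding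
  the Lambert series \<open>\<Sum>n\<ge>1. n p\<^sup>n / (1 - p\<^sup>n) (cos (2 n \<pi> x) - 1)\<close> in \<open>\<wp>(x)\<close> and \<open>\<wp>(x + 1/2)\<close>.
  The lemma \<open>H_potential_expansion\<close> below justifies it.
\<close>
definition V_coeff :: "nat \<Rightarrow> nat \<Rightarrow> nat \<Rightarrow> real \<Rightarrow> real" where
  "V_coeff l0 l1 k x = - 8 * pi\<^sup>2 * (\<Sum>n | n dvd k. of_nat n *
     (of_nat (l0 * (l0 + 1)) * (cos (2 * of_nat n * pi * x) - 1) +
      of_nat (l1 * (l1 + 1)) * (cos (2 * of_nat n * pi * (x + 1 / 2)) - 1)))"

definition csc2 :: "complex \<Rightarrow> complex" where
  "csc2 w = of_real pi ^ 2 / (sin (of_real pi * w))\<^sup>2"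

lemma sin_pi_eq_0_iff_Ints: "sin (of_real pi * w) = 0 \<longleftrightarrow> w \<in> \<int>" for w :: complex
proof -
  have "(of_real pi * w = of_int n * of_real pi) \<longleftrightarrow> w = of_int n" for n
    by (simp add: mult.commute)
  then show ?thesis
    by (auto simp: sin_eq_0 Ints_def)
qed

lemma Polygamma_1_reflection:
  fixes z :: complex
  assumes z: "z \<notin> \<int>"
  shows "Polygamma 1 z + Polygamma 1 (1 - z) = csc2 z"
proof -
  have ni: "w \<notin> \<int>\<^sub>\<le>\<^sub>0" "1 - w \<notin> \<int>\<^sub>\<le>\<^sub>0" if "w \<notin> \<int>" for w :: complex
    using that by (metis nonpos_Ints_Int Ints_1 Ints_diff diff_diff_eq2 add_diff_cancel_left' )+
  have open': "open (- \<int> :: complex set)"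
    by (simp add: closed_Ints open_Compl)
  have dg: "Digamma (1 - w) - Digamma w = of_real pi * cos (of_real pi * w) / sin (of_real pi * w)"
    if w: "w \<notin> \<int>" for w :: complex
  proof -
    define s where "s = sin (of_real pi * w)"
    define k where "k = cos (of_real pi * w)"
    have s0: "s \<noteq> 0" unfolding s_def using w sin_pi_eq_0_iff_Ints by blast
    have 1: "((\<lambda>z. Gamma z * Gamma (1 - z)) has_field_derivative
        (Gamma w * Gamma (1 - w) * (Digamma w - Digamma (1 - w)))) (at w)"
      by (rule derivative_eq_intros refl ni[OF w])+ (simp add: algebra_simps)
    have 2: "((\<lambda>z. of_real pi / sin (of_real pi * z)) has_field_derivative
        (- (of_real pi * of_real pi * k / s\<^sup>2))) (at w)"
      using s0 unfolding s_def k_def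
      by (auto intro!: derivative_eq_intros simp: power2_eq_square field_simps)
    have "(\<lambda>z::complex. Gamma z * Gamma (1 - z)) = (\<lambda>z. of_real pi / sin (of_real pi * z))"
      using Gamma_reflection_complex by blast
    then have "Gamma w * Gamma (1 - w) * (Digamma w - Digamma (1 - w)) = - (of_real pi * of_real pi * k / s\<^sup>2)"
      using 1 2 by (metis DERIV_unique)
    then have "of_real pi / s * (Digamma w - Digamma (1 - w)) = - (of_real pi * of_real pi * k / s\<^sup>2)"
      by (simp add: Gamma_reflection_complex s_def)
    then have "(of_real pi / s) * (Digamma w - Digamma (1 - w)) = (of_real pi / s) * (- (of_real pi * k / s))"
      by (simp add: power2_eq_square)
    then have "Digamma w - Digamma (1 - w) = - (of_real pi * k / s)"
      using s0 by (subst (asm) mult_cancel_left) auto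
    then show ?thesis
      unfolding s_def k_def by (simp add: algebra_simps)
  qed
  define s where "s = sin (of_real pi * z)"
  define k where "k = cos (of_real pi * z)"
  have s0: "s \<noteq> 0" unfolding s_def using z sin_pi_eq_0_iff_Ints by blast
  have sk: "s\<^sup>2 + k\<^sup>2 = 1" by (simp add: s_def k_def)
  have 1: "((\<lambda>z. Digamma (1 - z) - Digamma z) has_field_derivative
      (- Polygamma 1 (1 - z) - Polygamma 1 z)) (at z)"
    by (rule derivative_eq_intros refl ni[OF z])+ simp
  have "((\<lambda>z. of_real pi * cos (of_real pi * z) / sin (of_real pi * z)) has_field_derivative
      ((- (of_real pi * (s * of_real pi)) * s - of_real pi * k * (k * of_real pi)) / (s * s))) (at z)"
    using s0 unfolding s_def k_def
    by (auto intro!: derivative_eq_intros simp: mult_ac)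
  also have "(- (of_real pi * (s * of_real pi)) * s - of_real pi * k * (k * of_real pi)) / (s * s) =
      - (of_real pi ^ 2 * (s\<^sup>2 + k\<^sup>2) / s\<^sup>2)"
    unfolding minus_divide_left
    by (rule arg_cong2[where f = "(/)"]) (simp_all add: power2_eq_square algebra_simps)
  finally have "((\<lambda>z. of_real pi * cos (of_real pi * z) / sin (of_real pi * z)) has_field_derivative
      (- (of_real pi ^ 2 * (s\<^sup>2 + k\<^sup>2) / s\<^sup>2))) (at z)" .
  then have 2: "((\<lambda>z. Digamma (1 - z) - Digamma z) has_field_derivative
      (- (of_real pi ^ 2 / s\<^sup>2))) (at z)"
    unfolding sk
    by (subst (asm) DERIV_cong_ev[OF refl _ refl])
       (use eventually_nhds_in_open[OF open', of z] z dg in \<open>auto elim!: eventually_mono\<close>)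
  show ?thesis
    using DERIV_unique[OF 1 2] unfolding csc2_def s_def by (simp add: algebra_simps)
qed

lemma csc2_has_sum:
  assumes w: "w \<notin> \<int>"
  shows "((\<lambda>m::int. 1 / (w - of_int m)\<^sup>2) has_sum csc2 w) UNIV"
proof -
  have key: "((\<lambda>k::nat. 1 / (u + of_nat k)\<^sup>2) has_sum Polygamma 1 u) UNIV" if u: "u \<notin> \<int>" for u :: complex
  proof -
    have u0: "u \<noteq> 0" using u by auto
    have "(\<lambda>k. inverse ((u + of_nat k) ^ Suc 1)) sums ((-1) ^ Suc 1 * Polygamma 1 u / fact 1)"
      by (rule Polygamma_LIMSEQ) (use u0 in auto)
    then have s: "(\<lambda>k. 1 / (u + of_nat k)\<^sup>2) sums Polygamma 1 u"
      by (simp add: field_simps power2_eq_square)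
    have "summable (\<lambda>k. norm (1 / (u + of_nat k)\<^sup>2))"
    proof (rule summable_comparison_test')
      show "summable (\<lambda>n. 4 * inverse (real n ^ 2))"
        by (intro summable_mult inverse_power_summable) auto
      fix k assume k: "k \<ge> Suc (nat \<lceil>2 * norm u\<rceil>)"
      then have k': "real k \<ge> 2 * norm u" "k > 0"
        by linarith+
      have "norm (u + of_nat k) \<ge> norm (of_nat k :: complex) - norm u"
        by (metis norm_diff_ineq add.commute)
      with k' have "norm (u + of_nat k) \<ge> real k / 2"
        by simp
      then have "norm (u + of_nat k) ^ 2 \<ge> (real k / 2) ^ 2"
        by (intro power_mono) auto
      then have "1 / norm (u + of_nat k) ^ 2 \<le> 1 / (real k / 2) ^ 2"
        using k' by (intro divide_left_mono) (auto intro!: mult_pos_pos simp: zero_less_power2)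
      then show "norm (norm (1 / (u + of_nat k)\<^sup>2)) \<le> 4 * inverse (real k ^ 2)"
        by (simp add: norm_divide norm_power power_divide field_simps)
    qed
    with s show ?thesis
      by (intro norm_summable_imp_has_sum)
  qed
  have w': "1 - w \<notin> \<int>"
    using w by (metis Ints_1 Ints_diff diff_diff_eq2 add_diff_cancel_left')
  have 1: "((\<lambda>m::int. 1 / (w - of_int m)\<^sup>2) has_sum Polygamma 1 w) {..0}"
    using key[OF w] by (rule has_sum_reindex_bij_witness[of _ "\<lambda>k. - int k" "\<lambda>m. nat (- m)", THEN iffD2, rotated -1]) auto
  have 2: "((\<lambda>m::int. 1 / (w - of_int m)\<^sup>2) has_sum Polygamma 1 (1 - w)) {1..}"
    using key[OF w'] 
    by (rule has_sum_reindex_bij_witness[of _ "\<lambda>k. int k + 1" "\<lambda>m. nat (m - 1)", THEN iffD2, rotated -1])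
       (auto simp: power2_commute algebra_simps)
  have U: "(UNIV :: int set) = {..0} \<union> {1..}" by auto
  show ?thesis
    using has_sum_Un_disjoint[OF 1 2] unfolding U Polygamma_1_reflection[OF w]
    by (rule meta_mp) auto
qed

lemma csc2_minus [simp]: "csc2 (- w) = csc2 w"
  by (simp add: csc2_def)

lemma csc2_q_expansion:
  assumes w: "Im w > 0"
  shows "((\<lambda>k. - 4 * of_real pi ^ 2 * (of_nat k * exp (2 * of_real pi * \<i> * w) ^ k)) has_sum csc2 w) {1..}"
proof -
  define q where "q = exp (2 * of_real pi * \<i> * w)"
  define e where "e = exp (of_real pi * \<i> * w)"
  have e0: "e \<noteq> 0" by (simp add: e_def)
  have q: "q = e\<^sup>2" unfolding q_def e_def by (simp add: exp_double [symmetric] mult.assoc)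
  have nq: "norm q < 1" using w by (simp add: q_def)
  then have q1: "q \<noteq> 1" by auto
  have ei: "exp (- (\<i> * (of_real pi * w))) = 1 / e"
    by (simp add: e_def exp_minus field_simps)
  have "sin (of_real pi * w) = (e - 1 / e) / (2 * \<i>)"
    unfolding sin_exp_eq ei by (simp add: e_def mult_ac)
  also have "\<dots> = (e\<^sup>2 - 1) / (2 * \<i> * e)"
    using e0 by (simp add: field_simps power2_eq_square)
  finally have "(sin (of_real pi * w))\<^sup>2 = - ((1 - q)\<^sup>2 / (4 * q))"
    by (simp add: q power_divide power_mult_distrib power2_commute)
  then have c: "csc2 w = - 4 * of_real pi ^ 2 * (q * (1 / (1 - q)\<^sup>2))"
    by (simp add: csc2_def)
  have s1: "(\<lambda>n. of_nat (Suc n) * q ^ n) sums (1 / (1 - q)^2)"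
    by (rule geometric_deriv_sums[OF nq])
  have "(\<lambda>n. of_nat (Suc n) * norm q ^ n) sums (1 / (1 - norm q)^2)"
    by (rule geometric_deriv_sums) (use nq in auto)
  then have "summable (\<lambda>n. of_nat (Suc n) * norm q ^ n)" by (rule sums_summable)
  then have "summable (\<lambda>n. norm (of_nat (Suc n) * q ^ n))"
    by (simp only: norm_mult norm_power norm_of_nat)
  then have "((\<lambda>n. of_nat (Suc n) * q ^ n) has_sum (1 / (1 - q)^2)) UNIV"
    using s1 by (rule norm_summable_imp_has_sum)
  then have "((\<lambda>n. q * (of_nat (Suc n) * q ^ n)) has_sum (q * (1 / (1 - q)^2))) UNIV"
    by (rule has_sum_cmult_right)
  then have "((\<lambda>n. of_nat n * q ^ n) has_sum (q * (1 / (1 - q)^2))) {1..}"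
    by (rule has_sum_reindex_bij_witness[of _ "Suc" "\<lambda>m. m - 1", THEN iffD2, rotated -1])
      (auto simp: power_eq_if mult_ac)
  then show ?thesis
    unfolding c q_def[symmetric] by (rule has_sum_cmult_right)
qed

lemma int_powr_summable: "(\<lambda>m::int. (1 + real_of_int \<bar>m\<bar>) powr (-3/2)) summable_on UNIV"
proof -
  have "summable (\<lambda>n. real n powr (-3/2))"
    by (simp add: summable_real_powr_iff)
  then have "summable (\<lambda>n. real (n + 1) powr (-3/2))"
    by (rule summable_ignore_initial_segment)
  then have *: "(\<lambda>n. (1 + real n) powr (-3/2)) summable_on UNIV"
    by (intro norm_summable_imp_summable_on) (simp add: add_ac)
  have 1: "(\<lambda>m::int. (1 + real_of_int \<bar>m\<bar>) powr (-3/2)) summable_on {0..}"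
    using * by (rule summable_on_reindex_bij_witness[of _ int nat, THEN iffD2, rotated -1]) auto
  have 2: "(\<lambda>m::int. (1 + real_of_int \<bar>m\<bar>) powr (-3/2)) summable_on {..0}"
    using * by (rule summable_on_reindex_bij_witness[of _ "\<lambda>n. - int n" "\<lambda>m. nat (-m)", THEN iffD2, rotated -1]) auto
  have "(\<lambda>m::int. (1 + real_of_int \<bar>m\<bar>) powr (-3/2)) summable_on ({0..} \<union> ({..0} - {0..}))"
    by (rule summable_on_Un_disjoint[OF 1 summable_on_subset_banach[OF 2]]) auto
  also have "{0..} \<union> ({..0} - {0..}) = (UNIV :: int set)" by auto
  finally show ?thesis .
qed

definition wp_term :: "complex \<Rightarrow> complex \<Rightarrow> int \<times> int \<Rightarrow> complex" where
  "wp_term \<tau> z = (\<lambda>(m, n). 1 / (z - of_int m - of_int n * \<tau>)\<^sup>2 - 1 / (of_int m + of_int n * \<tau>)\<^sup>2)"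

lemma wp_term_bound:
  fixes z W :: complex
  assumes W: "norm W \<ge> 2 * norm z" "norm W > 0"
  shows "norm (1 / (z - W)\<^sup>2 - 1 / W\<^sup>2) \<le> 10 * norm z / norm W ^ 3"
proof -
  have W0: "W \<noteq> 0" using W by auto
  have d: "norm (z - W) \<ge> norm W / 2"
    using norm_triangle_ineq2[of W z] W by (simp add: norm_minus_commute)
  then have zW: "z - W \<noteq> 0" using W by auto
  have e: "norm (2 * W - z) \<le> 5 / 2 * norm W"
    using norm_triangle_ineq4[of "2 * W" z] W by simp
  have "1 / (z - W)\<^sup>2 - 1 / W\<^sup>2 = z * (2 * W - z) / ((z - W)\<^sup>2 * W\<^sup>2)"
    using W0 zW by (simp add: divide_simps) (simp add: algebra_simps power2_eq_square)
  then have "norm (1 / (z - W)\<^sup>2 - 1 / W\<^sup>2) = norm z * norm (2 * W - z) / ((norm (z - W))\<^sup>2 * (norm W)\<^sup>2)"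
    by (simp add: norm_divide norm_mult norm_power)
  also have "\<dots> \<le> norm z * (5 / 2 * norm W) / ((norm W / 2)\<^sup>2 * (norm W)\<^sup>2)"
    using W d e by (intro frac_le mult_mono power_mono) auto
  also have "\<dots> = 10 * norm z / norm W ^ 3"
    using W by (simp add: field_simps power2_eq_square power3_eq_cube)
  finally show ?thesis .
qed

lemma wp_term_summable:
  assumes \<tau>: "Im \<tau> > 0"
  shows "wp_term \<tau> z summable_on UNIV"
proof -
  define B where "B = 1 + norm \<tau> / Im \<tau> + 1 / Im \<tau>"
  have B: "B \<ge> 1" using \<tau> by (simp add: B_def)
  have bnd: "\<bar>real_of_int m\<bar> \<le> B * norm (of_int m + of_int n * \<tau>)" "\<bar>real_of_int n\<bar> \<le> B * norm (of_int m + of_int n * \<tau>)" for m n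
  proof -
    define W where "W = of_int m + of_int n * \<tau>"
    have "\<bar>real_of_int n\<bar> * Im \<tau> = \<bar>Im W\<bar>" using \<tau> by (simp add: W_def abs_mult)
    also have "\<dots> \<le> norm W" by (rule abs_Im_le_cmod)
    finally have n: "\<bar>real_of_int n\<bar> \<le> norm W / Im \<tau>" using \<tau> by (simp add: field_simps)
    have "\<bar>real_of_int m\<bar> = norm (W - of_int n * \<tau>)" by (simp add: W_def)
    also have "\<dots> \<le> norm W + norm (of_int n * \<tau>)" by (rule norm_triangle_ineq4)
    also have "\<dots> = norm W + \<bar>real_of_int n\<bar> * norm \<tau>" by (simp add: norm_mult)
    also have "\<dots> \<le> norm W + norm W / Im \<tau> * norm \<tau>"
      using n by (intro add_left_mono mult_right_mono) auto
    finally have m: "\<bar>real_of_int m\<bar> \<le> norm W + norm W / Im \<tau> * norm \<tau>" .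
    have "norm W + norm W / Im \<tau> * norm \<tau> \<le> B * norm W" "norm W / Im \<tau> \<le> B * norm W"
      using \<tau> by (auto simp: B_def algebra_simps)
    with m n show "\<bar>real_of_int m\<bar> \<le> B * norm W" "\<bar>real_of_int n\<bar> \<le> B * norm W" by linarith+
  qed
  define R where "R = 2 * norm z + 1"
  define E where "E = {(m, n). norm (of_int m + of_int n * \<tau>) < R}"
  have "E \<subseteq> {- \<lceil>B * R\<rceil>..\<lceil>B * R\<rceil>} \<times> {- \<lceil>B * R\<rceil>..\<lceil>B * R\<rceil>}"
  proof
    fix y assume "y \<in> E"
    then obtain m n where y: "y = (m, n)" "norm (of_int m + of_int n * \<tau>) < R" by (auto simp: E_def)
    then have "B * norm (of_int m + of_int n * \<tau>) \<le> B * R" using B by (intro mult_left_mono) auto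
    with bnd[where m = m and n = n] have "\<bar>real_of_int m\<bar> \<le> B * R" "\<bar>real_of_int n\<bar> \<le> B * R" by linarith+
    then have "\<bar>m\<bar> \<le> \<lceil>B * R\<rceil>" "\<bar>n\<bar> \<le> \<lceil>B * R\<rceil>" by linarith+
    then show "y \<in> {- \<lceil>B * R\<rceil>..\<lceil>B * R\<rceil>} \<times> {- \<lceil>B * R\<rceil>..\<lceil>B * R\<rceil>}" by (auto simp: y(1))
  qed
  then have finE: "finite E" by (rule finite_subset) auto
  define g where "g = (\<lambda>(m::int, n::int). (1 + real_of_int \<bar>m\<bar>) powr (-3/2) * (1 + real_of_int \<bar>n\<bar>) powr (-3/2))"
  define S where "S = (\<Sum>\<^sub>\<infinity>n::int. (1 + real_of_int \<bar>n\<bar>) powr (-3/2))"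
  have "g summable_on UNIV \<times> UNIV"
  proof (rule summable_on_SigmaI)
    show "((\<lambda>n. g (m, n)) has_sum (1 + real_of_int \<bar>m\<bar>) powr (-3/2) * S) UNIV" for m
      unfolding g_def S_def prod.case
      by (intro has_sum_cmult_right has_sum_infsum int_powr_summable)
    show "(\<lambda>m::int. (1 + real_of_int \<bar>m\<bar>) powr (-3/2) * S) summable_on UNIV"
      by (intro summable_on_cmult_left int_powr_summable)
  qed (auto simp: g_def)
  then have gs: "(\<lambda>x. 10 * norm z * (1 + B) ^ 3 * g x) summable_on (- E)"
    by (intro summable_on_cmult_right) (auto intro: summable_on_subset_banach)
  have "(\<lambda>x. norm (wp_term \<tau> z x)) summable_on (- E)"
  proof (rule summable_on_comparison_test[OF gs])
    fix x assume "x \<in> - E"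
    moreover obtain m n where x: "x = (m, n)" by force
    ultimately have W: "norm (of_int m + of_int n * \<tau>) \<ge> R" by (auto simp: E_def)
    define W where "W = of_int m + of_int n * \<tau>"
    have W1: "norm W \<ge> 1" "norm W \<ge> 2 * norm z" using W by (auto simp: W_def R_def intro: order_trans[rotated])
    have "1 + real_of_int \<bar>m\<bar> \<le> (1 + B) * norm W" "1 + real_of_int \<bar>n\<bar> \<le> (1 + B) * norm W"
      using bnd[where m = m and n = n] W1 by (auto simp: W_def algebra_simps)
    then have "(1 + real_of_int \<bar>m\<bar>) * (1 + real_of_int \<bar>n\<bar>) \<le> ((1 + B) * norm W) * ((1 + B) * norm W)"
      by (intro mult_mono) auto
    then have "((1 + real_of_int \<bar>m\<bar>) * (1 + real_of_int \<bar>n\<bar>)) powr (3/2) \<le> (((1 + B) * norm W) ^ 2) powr (3/2)"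
      by (intro powr_mono2) (auto simp: power2_eq_square)
    also have "(((1 + B) * norm W) ^ 2) powr (3/2) = ((1 + B) * norm W) ^ 3"
    proof -
      define b where "b = (1 + B) * norm W"
      have b: "b > 0" unfolding b_def using B W1 by (intro mult_pos_pos) auto
      have "(b ^ 2) powr (3/2) = (b powr 2) powr (3/2)" using b by simp
      also have "\<dots> = b powr 3" by (simp only: powr_powr) simp
      also have "\<dots> = b ^ 3" using b by simp
      finally show ?thesis unfolding b_def .
    qed
    finally have le: "((1 + real_of_int \<bar>m\<bar>) * (1 + real_of_int \<bar>n\<bar>)) powr (3/2) \<le> (1 + B) ^ 3 * norm W ^ 3"
      by (simp add: power_mult_distrib)
    define P where "P = ((1 + real_of_int \<bar>m\<bar>) * (1 + real_of_int \<bar>n\<bar>)) powr (3/2)"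
    have P0: "P > 0" by (auto simp: P_def)
    have gP: "g x = 1 / P"
      by (simp add: g_def x P_def powr_mult powr_minus inverse_eq_divide)
    have "norm (wp_term \<tau> z x) = norm (1 / (z - W)\<^sup>2 - 1 / W\<^sup>2)"
      by (simp add: wp_term_def x W_def diff_diff_eq)
    also have "\<dots> \<le> 10 * norm z / norm W ^ 3"
      by (rule wp_term_bound) (use W1 in auto)
    also have "\<dots> \<le> 10 * norm z * ((1 + B) ^ 3 / P)"
    proof -
      have "1 / norm W ^ 3 \<le> (1 + B) ^ 3 / P"
        using le P0 W1 B unfolding P_def[symmetric] by (simp add: divide_simps)
      from mult_left_mono[OF this, of "10 * norm z"] show ?thesis by simp
    qed
    finally show "norm (wp_term \<tau> z x) \<le> 10 * norm z * (1 + B) ^ 3 * g x"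
      by (simp add: gP)
  qed auto
  then have 1: "wp_term \<tau> z summable_on (- E)" by (rule abs_summable_summable)
  have 2: "wp_term \<tau> z summable_on E" using finE by (rule summable_on_finite)
  show ?thesis
    using summable_on_Un_disjoint[OF 1 2] by (simp add: Compl_partition2)
qed

lemma has_sum_diff:
  fixes f g :: "'a \<Rightarrow> complex"
  assumes "(f has_sum a) S" "(g has_sum b) S"
  shows "((\<lambda>x. f x - g x) has_sum (a - b)) S"
  using has_sum_add[OF assms(1) has_sum_uminusI[OF assms(2)]] by simp

lemma divisor_bij: 
  fixes F :: "nat \<Rightarrow> nat \<Rightarrow> complex"
  assumes "((\<lambda>(n, k). F n k) has_sum S) ({1..} \<times> {1..})"
  shows "((\<lambda>N. \<Sum>k | k dvd N. F (N div k) k) has_sum S) {1..}"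
proof -
  have "((\<lambda>(N, k). F (N div k) k) has_sum S) (SIGMA N:{1..}. {k. k dvd N})"
    using assms
  proof (rule has_sum_reindex_bij_witness[of _ "\<lambda>(n, k). (n * k, k)" "\<lambda>(N, k). (N div k, k)", THEN iffD2, rotated -1])
  qed (auto simp: Suc_le_eq dvd_div_eq_0_iff intro!: Nat.gr0I)
  then show ?thesis
    by (rule has_sum_SigmaD) (auto intro!: has_sum_finite)
qed

lemma wp_expansion:
  fixes x :: real
  assumes \<tau>: "Im \<tau> > 0" and x: "x \<notin> \<int>"
  defines "p \<equiv> exp (2 * of_real pi * \<i> * \<tau>)"
  shows "((\<lambda>N. of_real (- 8 * pi\<^sup>2 * (\<Sum>n | n dvd N. of_nat n * (cos (2 * of_nat n * pi * x) - 1))) * p ^ N) has_sum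
           (wp \<tau> (of_real x) - of_real (pi\<^sup>2 / (sin (pi * x))\<^sup>2 - pi\<^sup>2 / 3))) {1..}"
proof -
  define z where "z = complex_of_real x"
  have zZ: "z \<notin> \<int>" using x unfolding z_def by simp
  have z0: "z \<noteq> 0" using zZ by auto
  have NI: "w \<notin> \<int>" if "Im w \<noteq> 0" for w using that by (metis complex_is_Int_iff)
  define f where "f = wp_term \<tau> z"
  have f: "f summable_on UNIV" unfolding f_def by (rule wp_term_summable[OF \<tau>])
  have "infsum f UNIV = infsum f (insert (0,0) (UNIV - {(0,0)}))" by (simp add: insert_absorb)
  also have "\<dots> = f (0,0) + infsum f (UNIV - {(0,0)})"
    by (rule infsum_insert) (auto intro: summable_on_subset_banach[OF f])
  also have "\<dots> = wp \<tau> z" by (simp add: wp_def f_def wp_term_def)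
  finally have fw: "(f has_sum wp \<tau> z) (UNIV \<times> UNIV)" using has_sum_infsum[OF f] by simp
  have fw': "((\<lambda>(n, m). f (m, n)) has_sum wp \<tau> z) (UNIV \<times> UNIV)"
    by (rule has_sum_reindex_bij_witness[of _ prod.swap prod.swap, THEN iffD2, rotated -1, OF fw]) auto
  define A where "A n = (if n = 0 then csc2 z - of_real pi ^ 2 / 3 else csc2 (z - of_int n * \<tau>) - csc2 (of_int n * \<tau>))" for n :: int
  have sq: "((\<lambda>m::int. 1 / (of_int m)\<^sup>2) has_sum (of_real pi ^ 2 / 3 :: complex)) UNIV"
  proof -
    have s: "(\<lambda>n. 1 / (1 + real n)\<^sup>2) sums (pi\<^sup>2 / 6)" using inverse_squares_sums by (simp add: add_ac)
    then have "((\<lambda>n. 1 / (1 + real n)\<^sup>2) has_sum (pi\<^sup>2 / 6)) UNIV"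
      by (intro norm_summable_imp_has_sum) (auto dest: sums_summable)
    then have n: "((\<lambda>n. of_real (1 / (1 + real n)\<^sup>2)) has_sum (of_real (pi\<^sup>2 / 6) :: complex)) UNIV"
      by (rule has_sum_of_real)
    have 1: "((\<lambda>m::int. 1 / (of_int m)\<^sup>2) has_sum (of_real (pi\<^sup>2 / 6) :: complex)) {1..}"
      by (rule has_sum_reindex_bij_witness[of _ "\<lambda>n. int n + 1" "\<lambda>m. nat (m - 1)", THEN iffD2, rotated -1, OF n])
         (auto simp: add_ac)
    have 2: "((\<lambda>m::int. 1 / (of_int m)\<^sup>2) has_sum (of_real (pi\<^sup>2 / 6) :: complex)) {..-1}"
      by (rule has_sum_reindex_bij_witness[of _ "uminus" "uminus", THEN iffD2, rotated -1, OF 1]) auto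
    have 3: "((\<lambda>m::int. 1 / (of_int m)\<^sup>2) has_sum (0 :: complex)) {0}"
      by (rule has_sum_finiteI) auto
    have "((\<lambda>m::int. 1 / (of_int m)\<^sup>2) has_sum (of_real (pi\<^sup>2 / 6) + of_real (pi\<^sup>2 / 6) :: complex)) ({1..} \<union> {..-1})"
      by (rule has_sum_Un_disjoint[OF 1 2]) auto
    then have "((\<lambda>m::int. 1 / (of_int m)\<^sup>2) has_sum (of_real (pi\<^sup>2 / 6) + of_real (pi\<^sup>2 / 6) + 0 :: complex)) (({1..} \<union> {..-1}) \<union> {0})"
      by (rule has_sum_Un_disjoint[OF _ 3]) auto
    also have "(({1..} \<union> {..-1}) \<union> {0}) = (UNIV :: int set)" by auto
    finally show ?thesis by (simp add: field_simps)
  qed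
  have fA: "((\<lambda>m. f (m, n)) has_sum A n) UNIV" for n
  proof -
    have 1: "((\<lambda>m. 1 / (z - of_int n * \<tau> - of_int m)\<^sup>2) has_sum csc2 (z - of_int n * \<tau>)) UNIV"
      by (rule csc2_has_sum, cases "n = 0") (use zZ \<tau> in \<open>auto simp: z_def intro!: NI\<close>)
    have 2: "((\<lambda>m. 1 / (of_int m + of_int n * \<tau>)\<^sup>2) has_sum (if n = 0 then of_real pi ^ 2 / 3 else csc2 (of_int n * \<tau>))) UNIV"
    proof (cases "n = 0")
      case False
      have "((\<lambda>m. 1 / (- of_int n * \<tau> - of_int m)\<^sup>2) has_sum csc2 (- of_int n * \<tau>)) UNIV"
        by (rule csc2_has_sum) (use False \<tau> in \<open>auto intro!: NI\<close>)
      moreover have "(- of_int n * \<tau> - of_int m)\<^sup>2 = (of_int m + of_int n * \<tau>)\<^sup>2" for m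
        by (simp add: power2_eq_square algebra_simps)
      ultimately show ?thesis using False by simp
    qed (use sq in simp)
    show ?thesis
      using has_sum_diff[OF 1 2] by (simp add: f_def wp_term_def A_def algebra_simps split: if_splits)
  qed
  have A: "(A has_sum wp \<tau> z) UNIV"
    by (rule has_sum_SigmaD[OF fw']) (use fA in simp)
  have As: "A summable_on X" for X
    by (rule summable_on_subset_banach[OF has_sum_imp_summable[OF A]]) simp
  have "(A has_sum infsum A {1..}) {1..}" "(A has_sum infsum A {..-1}) {..-1}" "(A has_sum A 0) {0}"
    by (rule has_sum_infsum[OF As], rule has_sum_infsum[OF As], rule has_sum_finiteI) auto
  note A1 = this
  have "(A has_sum infsum A {1..} + infsum A {..-1}) ({1..} \<union> {..-1})"
    by (rule has_sum_Un_disjoint[OF A1(1,2)]) auto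
  then have "(A has_sum infsum A {1..} + infsum A {..-1} + A 0) (({1..} \<union> {..-1}) \<union> {0})"
    by (rule has_sum_Un_disjoint[OF _ A1(3)]) auto
  also have "(({1..} \<union> {..-1}) \<union> {0}) = (UNIV :: int set)" by auto
  finally have "infsum A {1..} + infsum A {..-1} + A 0 = wp \<tau> z"
    by (rule has_sum_unique[OF _ A])
  then have tot: "infsum A {1..} + infsum A {..-1} = wp \<tau> z - A 0"
    by (simp add: eq_diff_eq)
  have "((\<lambda>n. A (int n)) has_sum infsum A {1..}) {1..}"
    by (rule has_sum_reindex_bij_witness[of _ nat int, THEN iffD2, rotated -1, OF A1(1)]) auto
  moreover have "((\<lambda>n. A (- int n)) has_sum infsum A {..-1}) {1..}"
    by (rule has_sum_reindex_bij_witness[of _ "\<lambda>m. nat (- m)" "\<lambda>n. - int n", THEN iffD2, rotated -1, OF A1(2)]) auto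
  ultimately have Anat: "((\<lambda>n. A (int n) + A (- int n)) has_sum (wp \<tau> z - A 0)) {1..}"
    unfolding tot[symmetric] by (rule has_sum_add)
  define F where "F n k = - 8 * of_real pi ^ 2 * (of_nat k * p ^ (n * k) * (of_real (cos (2 * of_nat k * pi * x)) - 1))" for n k :: nat
  have FA: "((\<lambda>k. F n k) has_sum A (int n) + A (- int n)) {1..}" if n: "n \<ge> 1" for n
  proof -
    have I: "Im (of_nat n * \<tau>) > 0" using n \<tau> by simp
    note q = csc2_q_expansion
    have 1: "((\<lambda>k. - 4 * of_real pi ^ 2 * (of_nat k * exp (2 * of_real pi * \<i> * (of_nat n * \<tau> - z)) ^ k)) has_sum csc2 (of_nat n * \<tau> - z)) {1..}"
      by (rule q) (use I in \<open>simp add: z_def\<close>)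
    have 2: "((\<lambda>k. - 4 * of_real pi ^ 2 * (of_nat k * exp (2 * of_real pi * \<i> * (of_nat n * \<tau> + z)) ^ k)) has_sum csc2 (of_nat n * \<tau> + z)) {1..}"
      by (rule q) (use I in \<open>simp add: z_def\<close>)
    have 3: "((\<lambda>k. - 4 * of_real pi ^ 2 * (of_nat k * exp (2 * of_real pi * \<i> * (of_nat n * \<tau>)) ^ k)) has_sum csc2 (of_nat n * \<tau>)) {1..}"
      by (rule q) (use I in simp)
    have e: "exp (2 * of_real pi * \<i> * (of_nat n * \<tau> + u)) ^ k = p ^ (n * k) * exp (\<i> * (2 * of_nat k * of_real pi * u))" for u k
      unfolding p_def exp_of_nat_mult[symmetric] exp_add[symmetric] by (rule arg_cong[where f = exp]) (simp add: algebra_simps)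
    have c: "exp (\<i> * (2 * of_nat k * of_real pi * z)) + exp (\<i> * (2 * of_nat k * of_real pi * (- z))) = 2 * of_real (cos (2 * of_nat k * pi * x))" for k :: nat
    proof -
      have "complex_of_real (cos (2 * of_nat k * pi * x)) = cos (2 * of_nat k * of_real pi * z)"
        by (simp add: z_def flip: cos_of_real)
      then have "2 * complex_of_real (cos (2 * of_nat k * pi * x)) = exp (\<i> * (2 * of_nat k * of_real pi * z)) + exp (- (\<i> * (2 * of_nat k * of_real pi * z)))"
        unfolding cos_exp_eq by (simp only: times_divide_eq_right nonzero_mult_div_cancel_left
          zero_neq_numeral[symmetric] not_False_eq_True)
      then show ?thesis by simp
    qed
    have sm: "csc2 (of_nat n * \<tau> - z) - csc2 (of_nat n * \<tau>) + (csc2 (of_nat n * \<tau> + z) - csc2 (of_nat n * \<tau>)) = A (int n) + A (- int n)"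
      using n csc2_minus[of "of_nat n * \<tau> - z"] by (simp add: A_def add_ac)
    have Feq: "F n k = - 4 * of_real pi ^ 2 * (of_nat k * exp (2 * of_real pi * \<i> * (of_nat n * \<tau> - z)) ^ k) -
       - 4 * of_real pi ^ 2 * (of_nat k * exp (2 * of_real pi * \<i> * (of_nat n * \<tau>)) ^ k) +
       (- 4 * of_real pi ^ 2 * (of_nat k * exp (2 * of_real pi * \<i> * (of_nat n * \<tau> + z)) ^ k) -
       - 4 * of_real pi ^ 2 * (of_nat k * exp (2 * of_real pi * \<i> * (of_nat n * \<tau>)) ^ k))" for k
    proof -
      define E1 where "E1 = exp (\<i> * (2 * of_nat k * of_real pi * z))"
      define E2 where "E2 = exp (\<i> * (2 * of_nat k * of_real pi * (- z)))"
      have c': "complex_of_real (cos (2 * of_nat k * pi * x)) = (E1 + E2) / 2"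
        using c[of k] unfolding E1_def E2_def by simp
      have e1: "exp (2 * of_real pi * \<i> * (of_nat n * \<tau> + z)) ^ k = p ^ (n * k) * E1"
        unfolding E1_def by (rule e)
      have e2: "exp (2 * of_real pi * \<i> * (of_nat n * \<tau> - z)) ^ k = p ^ (n * k) * E2"
        unfolding E2_def using e[of "- z"] by simp
      have e3: "exp (2 * of_real pi * \<i> * (of_nat n * \<tau>)) ^ k = p ^ (n * k)"
        using e[of 0] by simp
      show ?thesis unfolding F_def c' e1 e2 e3 by (simp add: field_simps)
    qed
    show ?thesis
      unfolding Feq sm[symmetric] by (intro has_sum_add has_sum_diff 1 2 3)
  qed
  define r where "r = norm p"
  have r: "0 \<le> r" "r < 1" using \<tau> by (auto simp: r_def p_def)
  have Fs: "(\<lambda>(n, k). F n k) summable_on {1..} \<times> {1..}"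
  proof -
    define G where "G = (\<lambda>(n::nat, k::nat). 16 * pi\<^sup>2 * (real k * (r ^ n) ^ k))"
    have hs: "((\<lambda>k. real k * s ^ k) has_sum (s / (1 - s)\<^sup>2)) {1..}" if s: "0 \<le> s" "s < 1" for s :: real
    proof -
      have g: "(\<lambda>n. real (Suc n) * s ^ n) sums (1 / (1 - s)^2)"
        using geometric_deriv_sums[of s] s by simp
      have "((\<lambda>n. real (Suc n) * s ^ n) has_sum (1 / (1 - s)^2)) UNIV"
        using s g by (intro norm_summable_imp_has_sum) (auto dest!: sums_summable simp: abs_mult)
      from has_sum_cmult_right[OF this, of s]
      have "((\<lambda>n. s * (real (Suc n) * s ^ n)) has_sum (s / (1 - s)^2)) UNIV" by simp
      then show ?thesis
        by (rule has_sum_reindex_bij_witness[of _ "Suc" "\<lambda>m. m - 1", THEN iffD2, rotated -1])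
           (auto simp: power_eq_if mult_ac)
    qed
    have "G summable_on {1..} \<times> {1..}"
    proof (rule summable_on_SigmaI)
      fix n :: nat assume "n \<in> {1..}"
      then show "((\<lambda>k. G (n, k)) has_sum (16 * pi\<^sup>2 * (r ^ n / (1 - r ^ n)\<^sup>2))) {1..}"
        unfolding G_def prod.case using r
        by (intro has_sum_cmult_right hs) (auto simp: power_less_one_iff)
    next
      have "(\<lambda>n. r ^ n) summable_on {1..}"
        using has_sum_geometric_from_1[of r] r has_sum_imp_summable by fastforce
      then have "(\<lambda>n. 16 * pi\<^sup>2 / (1 - r)\<^sup>2 * r ^ n) summable_on {1..}"
        by (rule summable_on_cmult_right)
      then show "(\<lambda>n. 16 * pi\<^sup>2 * (r ^ n / (1 - r ^ n)\<^sup>2)) summable_on {1..}"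
      proof (rule summable_on_comparison_test)
        fix n :: nat assume n: "n \<in> {1..}"
        then have "r ^ n \<le> r" using r power_decreasing[of 1 n r] by simp
        then have "r ^ n / (1 - r ^ n)\<^sup>2 \<le> r ^ n / (1 - r)\<^sup>2"
          using r by (intro divide_left_mono power_mono mult_pos_pos) auto
        then have "16 * pi\<^sup>2 * (r ^ n / (1 - r ^ n)\<^sup>2) \<le> 16 * pi\<^sup>2 * (r ^ n / (1 - r)\<^sup>2)"
          by (intro mult_left_mono) auto
        then show "16 * pi\<^sup>2 * (r ^ n / (1 - r ^ n)\<^sup>2) \<le> 16 * pi\<^sup>2 / (1 - r)\<^sup>2 * r ^ n" by simp
      qed (use r in auto)
    qed (use r in \<open>auto simp: G_def\<close>)
    then have "(\<lambda>y. norm (case y of (n, k) \<Rightarrow> F n k)) summable_on {1..} \<times> {1..}"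
    proof (rule summable_on_comparison_test)
      fix y :: "nat \<times> nat"
      obtain n k where y: "y = (n, k)" by force
      have "norm (of_real (cos (2 * of_nat k * pi * x)) - 1 :: complex) \<le> 2"
      proof -
        have "of_real (cos (2 * of_nat k * pi * x)) - 1 = complex_of_real (cos (2 * of_nat k * pi * x) - 1)" by simp
        then have "norm (of_real (cos (2 * of_nat k * pi * x)) - 1 :: complex) = \<bar>cos (2 * of_nat k * pi * x) - 1\<bar>"
          by (simp only: norm_of_real)
        also have "\<dots> \<le> 2" using cos_le_one[of "2 * of_nat k * pi * x"] cos_ge_minus_one[of "2 * of_nat k * pi * x"] by linarith
        finally show ?thesis .
      qed
      then have "8 * pi\<^sup>2 * (real k * r ^ (n * k) * norm (of_real (cos (2 * of_nat k * pi * x)) - 1 :: complex)) \<le> 8 * pi\<^sup>2 * (real k * r ^ (n * k) * 2)"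
        using r by (intro mult_left_mono) auto
      then show "norm (case y of (n, k) \<Rightarrow> F n k) \<le> G y"
        by (simp add: y F_def G_def norm_mult norm_power r_def power_mult)
    qed auto
    then show ?thesis by (rule abs_summable_summable)
  qed
  have "((\<lambda>(n, k). F n k) has_sum (wp \<tau> z - A 0)) ({1..} \<times> {1..})"
    by (rule has_sum_SigmaI[OF _ Anat Fs]) (use FA in auto)
  then have "((\<lambda>N. \<Sum>k | k dvd N. F (N div k) k) has_sum (wp \<tau> z - A 0)) {1..}"
    by (rule divisor_bij)
  moreover have "A 0 = of_real (pi\<^sup>2 / (sin (pi * x))\<^sup>2 - pi\<^sup>2 / 3)"
    by (simp add: A_def csc2_def z_def flip: sin_of_real)
  moreover have "(\<Sum>k | k dvd N. F (N div k) k) =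
      of_real (- 8 * pi\<^sup>2 * (\<Sum>n | n dvd N. of_nat n * (cos (2 * of_nat n * pi * x) - 1))) * p ^ N" for N
  proof -
    have "(\<Sum>k | k dvd N. F (N div k) k) = (\<Sum>k | k dvd N. - 8 * of_real pi ^ 2 * (of_nat k * (of_real (cos (2 * of_nat k * pi * x)) - 1)) * p ^ N)"
      by (rule sum.cong) (auto simp: F_def)
    then show ?thesis by (simp add: sum_distrib_left sum_distrib_right mult_ac)
  qed
  ultimately show ?thesis unfolding z_def by simp
qed

lemma H_potential_expansion:
  fixes x :: real
  assumes \<tau>: "Im \<tau> > 0" and x: "sin (pi * x) \<noteq> 0" "cos (pi * x) \<noteq> 0"
  defines "p \<equiv> exp (2 * of_real pi * \<i> * \<tau>)"
  shows "((\<lambda>k. of_real (V_coeff l0 l1 k x) * p ^ k) has_sum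
           (H_potential l0 l1 \<tau> (of_real x) - of_real (HT_potential l0 l1 x - C_T l0 l1))) {1..}"
proof -
  have c: "cos (pi * x) = sin (pi * (x + 1/2))" by (simp add: sin_add distrib_left)
  have Z: "y \<notin> \<int>" if "sin (pi * y) \<noteq> 0" for y :: real
    using that by (metis Ints_cases mult.commute sin_zero_iff_int2)
  have 1: "x \<notin> \<int>" "x + 1/2 \<notin> \<int>" using x c Z by metis+
  show ?thesis
    using has_sum_add[OF
       has_sum_cmult_right[OF wp_expansion[OF \<tau> 1(1)], of "of_nat (l0 * (l0 + 1))"]
       has_sum_cmult_right[OF wp_expansion[OF \<tau> 1(2)], of "of_nat (l1 * (l1 + 1))"]]
    unfolding p_def[symmetric]
  proof (rule back_subst[of "\<lambda>f. (f has_sum _) _", OF back_subst[of "\<lambda>s. (_ has_sum s) _"]], goal_cases)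
    case 1
    show ?case by (simp add: H_potential_def HT_potential_def C_T_def c algebra_simps add_divide_distrib)
  next
    case 2
    show ?case
    proof
      fix k
      show "of_nat (l0 * (l0 + 1)) * (of_real (- 8 * pi\<^sup>2 * (\<Sum>n | n dvd k. of_nat n * (cos (2 * of_nat n * pi * x) - 1))) * p ^ k) +
        of_nat (l1 * (l1 + 1)) * (of_real (- 8 * pi\<^sup>2 * (\<Sum>n | n dvd k. of_nat n * (cos (2 * of_nat n * pi * (x + 1/2)) - 1))) * p ^ k) =
        of_real (V_coeff l0 l1 k x) * p ^ k"
      proof -
        have "V_coeff l0 l1 k x = of_nat (l0 * (l0 + 1)) * (- 8 * pi\<^sup>2 * (\<Sum>n | n dvd k. of_nat n * (cos (2 * of_nat n * pi * x) - 1))) +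
         of_nat (l1 * (l1 + 1)) * (- 8 * pi\<^sup>2 * (\<Sum>n | n dvd k. of_nat n * (cos (2 * of_nat n * pi * (x + 1/2)) - 1)))"
          unfolding V_coeff_def by (simp only: sum_distrib_left flip: sum.distrib) (rule sum.cong, auto simp: algebra_simps)
        then show ?thesis by (simp only: of_real_add of_real_mult of_real_of_nat_eq distrib_right mult.assoc)
      qed
    qed
  qed
qed


subsection \<open>The unperturbed eigenfunctions\<close>

text \<open>
  The functions of \<open>x\<close> are polymorphic, so that they can be used both for real and for complex \<open>x\<close>.
\<close>
definition hyp2F1 :: "'a \<Rightarrow> 'a \<Rightarrow> 'a \<Rightarrow> 'a \<Rightarrow> 'a :: {real_normed_field, banach}" where
  "hyp2F1 a b c z = (\<Sum>n. pochhammer a n * pochhammer b n / (pochhammer c n * fact n) * z ^ n)"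

text \<open>
  The normalisation that makes \<open>\<psi>\<^sub>m\<close> monic of degree \<open>m\<close> in \<open>cos (2 \<pi> x)\<close>; see \<open>psi_monic\<close> below.
\<close>
definition c_tilde :: "nat \<Rightarrow> nat \<Rightarrow> nat \<Rightarrow> real" where
  "c_tilde l0 l1 m =
     2 ^ m * pochhammer ((2 * of_nat l0 + 3) / 2) m / pochhammer (of_nat (l0 + l1 + 2 + m)) m"

definition psi :: "nat \<Rightarrow> nat \<Rightarrow> nat \<Rightarrow> 'a \<Rightarrow> 'a :: {real_normed_field, banach}" where
  "psi l0 l1 m x = of_real (c_tilde l0 l1 m) *
     hyp2F1 (- of_nat m) (of_nat (l0 + l1 + 2 + m)) ((2 * of_nat l0 + 3) / 2)
       ((1 - cos (2 * of_real pi * x)) / 2)"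

definition Phi :: "nat \<Rightarrow> nat \<Rightarrow> 'a \<Rightarrow> 'a :: {real_normed_field, banach}" where
  "Phi l0 l1 x = sin (of_real pi * x) ^ (l0 + 1) * cos (of_real pi * x) ^ (l1 + 1)"

definition v_eig :: "nat \<Rightarrow> nat \<Rightarrow> nat \<Rightarrow> 'a \<Rightarrow> 'a :: {real_normed_field, banach}" where
  "v_eig l0 l1 m x = Phi l0 l1 x * psi l0 l1 m x"

definition E_eig :: "nat \<Rightarrow> nat \<Rightarrow> nat \<Rightarrow> real" where
  "E_eig l0 l1 m = pi\<^sup>2 * (of_nat (l0 + l1 + 2 + 2 * m))\<^sup>2"

lemma hyp2F1_terminating:
  "hyp2F1 (- of_nat m) b c z =
     (\<Sum>n\<le>m. pochhammer (- of_nat m) n * pochhammer b n / (pochhammer c n * fact n) * z ^ n)"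
  unfolding hyp2F1_def
  by (rule suminf_finite) (auto simp: pochhammer_of_nat_eq_0_iff not_le)

lemma psi_monic:
  obtains P :: "'a :: {real_normed_field, banach} poly"
  where "degree P = m" "lead_coeff P = 1" "\<And>x. psi l0 l1 m x = poly P (cos (2 * of_real pi * x))"
proof -
  define a :: 'a where "a = of_nat (l0 + l1 + 2 + m)"
  define c :: 'a where "c = (2 * of_nat l0 + 3) / 2"
  define d where "d n = pochhammer (- of_nat m) n * pochhammer a n / (pochhammer c n * fact n)" for n
  define t :: 'a where "t = of_real (c_tilde l0 l1 m)"
  define P where "P = smult t (\<Sum>n\<le>m. smult (d n) ([:1 / 2, - (1 / 2):] ^ n))"
  have poly: "psi l0 l1 m x = poly P (cos (2 * of_real pi * x))" for x :: 'a
    unfolding psi_def hyp2F1_terminating P_def t_def d_def a_def c_def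
    by (simp add: poly_sum diff_divide_distrib)
  have deg: "degree ([:1 / 2, - (1 / 2):] ^ n :: 'a poly) = n" for n
    by (simp add: degree_power_eq)
  have a_real: "a = of_real (of_nat (l0 + l1 + 2 + m))" by (simp add: a_def)
  have c_real: "c = of_real ((2 * of_nat l0 + 3) / 2)" by (simp add: c_def)
  have "pochhammer (of_nat (l0 + l1 + 2 + m) :: real) m > 0" 
    by (rule pochhammer_pos) simp
  then have a0: "pochhammer a m \<noteq> 0" unfolding a_real pochhammer_of_real by simp
  have "pochhammer ((2 * of_nat l0 + 3) / 2 :: real) m > 0" 
    by (rule pochhammer_pos) simp
  then have c0: "pochhammer c m \<noteq> 0" unfolding c_real pochhammer_of_real by simp
  have t: "t = 2 ^ m * pochhammer c m / pochhammer a m"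
    unfolding t_def c_tilde_def a_real c_real pochhammer_of_real by simp
  have lc: "coeff ([:1 / 2, - (1 / 2):] ^ m :: 'a poly) m = (- (1 / 2)) ^ m"
    using lead_coeff_power[of "[:1 / 2, - (1 / 2):] :: 'a poly" m] unfolding deg by simp
  have "coeff P m = t * (\<Sum>n\<le>m. d n * coeff ([:1 / 2, - (1 / 2):] ^ n) m)"
    by (simp add: P_def coeff_sum)
  also have "(\<Sum>n\<le>m. d n * coeff ([:1 / 2, - (1 / 2):] ^ n) m) = (\<Sum>n\<in>{m}. d n * coeff ([:1 / 2, - (1 / 2):] ^ n) m)"
    by (rule sum.mono_neutral_right) (auto simp: deg intro!: coeff_eq_0)
  also have "t * \<dots> = t * (d m * (- (1 / 2)) ^ m)" by (simp add: lc)
  also have "\<dots> = 1"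
    using a0 c0 by (simp add: t d_def pochhammer_same power_divide flip: power_mult_distrib)
  finally have P1: "coeff P m = 1" .
  have "degree P \<le> m"
    unfolding P_def by (intro order.trans[OF degree_smult_le] degree_sum_le) (auto simp: deg intro: order.trans[OF degree_smult_le])
  moreover have "degree P \<ge> m" using P1 by (intro le_degree) simp
  ultimately have "degree P = m" by simp
  with P1 poly that show ?thesis by simp
qed

subsection \<open>The algorithm of perturbation\<close>

definition H_T :: "nat \<Rightarrow> nat \<Rightarrow> (real \<Rightarrow> real) \<Rightarrow> real \<Rightarrow> real" where
  "H_T l0 l1 f x = - deriv (deriv f) x + HT_potential l0 l1 x * f x"

text \<open>All functions to which this is applied are real-valued, hence no complex conjugation.\<close>
definition L2_inner :: "(real \<Rightarrow> real) \<Rightarrow> (real \<Rightarrow> real) \<Rightarrow> real" where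
  "L2_inner f g = integral {0..1} (\<lambda>x. f x * g x)"

text \<open>
  A formal power series \<open>v\<^sub>m(p)\<close> is represented by its coefficients \<open>c k m'\<close> (the coefficient of
  \<open>v\<^sub>m\<^sub>' p\<^sup>k\<close>); the following is then its \<open>k\<close>-th coefficient as a function of \<open>x\<close>.
\<close>
definition pert_vec ::
    "nat \<Rightarrow> nat \<Rightarrow> (nat \<Rightarrow> nat \<Rightarrow> real) \<Rightarrow> nat \<Rightarrow> 'a \<Rightarrow> 'a :: {real_normed_field, banach}" where
  "pert_vec l0 l1 c k x = (\<Sum>m' | c k m' \<noteq> 0. of_real (c k m') * v_eig l0 l1 m' x)"

text \<open>
  The eigenvalue equation and the normalisation are identities of formal power series in \<open>p\<close> and are
  stated coefficientwise. The equation is required away from the zeros of \<open>sin (\<pi> x)\<close> and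
  \<open>cos (\<pi> x)\<close>, where the potential of \<open>H_T\<close> may be singular.
\<close>
definition perturbation_series ::
    "nat \<Rightarrow> nat \<Rightarrow> nat \<Rightarrow> (nat \<Rightarrow> real) \<Rightarrow> (nat \<Rightarrow> nat \<Rightarrow> real) \<Rightarrow> bool" where
  "perturbation_series l0 l1 m Et c \<longleftrightarrow>
     Et 0 = E_eig l0 l1 m - C_T l0 l1 \<and>
     (\<forall>m'. c 0 m' = (if m' = m then 1 else 0)) \<and>
     (\<forall>k. finite {m'. c k m' \<noteq> 0}) \<and>
     (\<forall>k x. sin (pi * x) \<noteq> 0 \<and> cos (pi * x) \<noteq> 0 \<longrightarrow>
        H_T l0 l1 (pert_vec l0 l1 c k) x - C_T l0 l1 * pert_vec l0 l1 c k x +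
          (\<Sum>j=1..k. V_coeff l0 l1 j x * pert_vec l0 l1 c (k - j) x) =
        (\<Sum>j=0..k. Et j * pert_vec l0 l1 c (k - j) x)) \<and>
     (\<forall>k\<ge>1. (\<Sum>j=0..k. L2_inner (pert_vec l0 l1 c j) (pert_vec l0 l1 c (k - j))) = 0)"

end

theory Submission
  imports Defs
begin

text \<open>
  Every coefficient of \<open>v\<^sub>m(p)\<close> is \<open>\<Phi>\<close> times a polynomial \<open>P\<^sub>k\<close> in \<open>u = cos (2 \<pi> x)\<close>. In these terms
  the eigenvalue equation reads \<open>(T - E\<^sub>m) P\<^sub>k = \<Sum>j=1..k. (e\<^sub>j - V\<^sub>j) P\<^sub>k\<^sub>-\<^sub>j\<close>, where \<open>e\<^sub>j\<close> are the eigenvalue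
  coefficients and \<open>T\<close> is \<open>H\<^sub>T\<close> conjugated by \<open>\<Phi>\<close>, a second-order operator with polynomial
  coefficients (\<open>H_T_gauged\<close>, \<open>perturbation_series_poly\<close>).
  The claim follows once \<open>P\<^sub>k\<close> and \<open>e\<^sub>k\<close> grow at most geometrically in \<open>k\<close>, in a norm that controls the
  values of \<open>P\<^sub>k\<close>.

  The norm used is \<open>\<Sum>n. \<bar>p\<^sub>n\<bar> \<rho>\<^sup>n\<close> on the coefficients in the monomial basis. It is submultiplicative,
  it bounds the polynomial on the disc \<open>\<bar>u\<bar> \<le> \<rho>\<close>, and in it \<open>V\<^sub>k\<close> is bounded by \<open>W A\<^sup>k\<close>
  (\<open>wnorm_V_poly\<close>). The operator \<open>T\<close> is triangular in this basis: \<open>u\<^sup>n\<close> is sent to \<open>E\<^sub>n u\<^sup>n\<close> plus terms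
  in \<open>u ^ (n - 1)\<close> and \<open>u ^ (n - 2)\<close> with coefficients of order at most \<open>n\<^sup>2\<close>. Since \<open>E\<^sub>n - E\<^sub>m\<close> is
  itself of order \<open>n\<^sup>2\<close>, the lower terms are a small perturbation of the diagonal when \<open>\<rho>\<close> is large, and
  \<open>T - E\<^sub>m\<close> has a bounded inverse modulo \<open>\<psi>\<^sub>m\<close> (\<open>reduced_resolvent_bound\<close>).

  The component of \<open>P\<^sub>k\<close> along \<open>\<psi>\<^sub>m\<close> is fixed by the normalisation, which is quadratic in the lower
  orders. The sizes of the orders therefore satisfy
  \<open>y\<^sub>k \<le> C (\<Sum>j=1..<k. y\<^sub>j y\<^sub>k\<^sub>-\<^sub>j) + C A\<^sup>k\<close>, and such sequences grow geometrically
  (\<open>quadratic_majorant\<close>). On the real line \<open>\<bar>u\<bar> \<le> 1\<close>, so one \<open>\<rho>\<close> and hence one radius of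
  convergence serves all compact sets; for a compact set of complex \<open>x\<close>, \<open>\<rho>\<close> is chosen to be at least
  the maximum of \<open>\<bar>cos (2 \<pi> x)\<bar>\<close> on the set.
\<close>

section \<open>A weighted norm on polynomials\<close>

text \<open>
  The weight \<open>\<rho>\<close> plays two roles: the norm dominates the values of the polynomial on the disc of
  radius \<open>\<rho>\<close>, and for large \<open>\<rho>\<close> an operator that lowers the degree becomes small, because it trades
  a factor \<open>\<rho> ^ (n + 1)\<close> for \<open>\<rho> ^ n\<close>.
\<close>
definition wnorm :: "real \<Rightarrow> real poly \<Rightarrow> real" where
  "wnorm \<rho> P = (\<Sum>n\<le>degree P. \<bar>coeff P n\<bar> * \<rho> ^ n)"

lemma wnorm_eq_sum:
  assumes "degree P \<le> d"
  shows "wnorm \<rho> P = (\<Sum>n\<le>d. \<bar>coeff P n\<bar> * \<rho> ^ n)"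
  unfolding wnorm_def
  by (rule sum.mono_neutral_left) (use assms in \<open>auto simp: coeff_eq_0\<close>)

lemma wnorm_0 [simp]: "wnorm \<rho> 0 = 0"
  by (simp add: wnorm_def)

lemma wnorm_nonneg: "\<rho> \<ge> 0 \<Longrightarrow> wnorm \<rho> P \<ge> 0"
  unfolding wnorm_def by (intro sum_nonneg) auto

lemma wnorm_pCons: "wnorm \<rho> (pCons a P) = \<bar>a\<bar> + \<rho> * wnorm \<rho> P"
proof -
  have "wnorm \<rho> (pCons a P) = (\<Sum>n\<le>Suc (degree P). \<bar>coeff (pCons a P) n\<bar> * \<rho> ^ n)"
    by (rule wnorm_eq_sum) (rule degree_pCons_le)
  also have "\<dots> = \<bar>a\<bar> + \<rho> * wnorm \<rho> P"
    unfolding sum.atMost_Suc_shift by (simp add: wnorm_def sum_distrib_left mult_ac)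
  finally show ?thesis .
qed

lemma wnorm_smult: "wnorm \<rho> (smult a P) = \<bar>a\<bar> * wnorm \<rho> P"
  by (induction P) (auto simp: wnorm_pCons abs_mult algebra_simps)

lemma wnorm_minus: "wnorm \<rho> (- P) = wnorm \<rho> P"
  using wnorm_smult[of \<rho> "-1" P] by simp

lemma wnorm_add_le:
  assumes "\<rho> \<ge> 0"
  shows "wnorm \<rho> (P + Q) \<le> wnorm \<rho> P + wnorm \<rho> Q"
proof (induction P Q rule: poly_induct2)
  case (pCons a P b Q)
  have "\<rho> * wnorm \<rho> (P + Q) \<le> \<rho> * (wnorm \<rho> P + wnorm \<rho> Q)"
    by (rule mult_left_mono[OF pCons(1) assms])
  then show ?case
    using abs_triangle_ineq[of a b] by (simp add: wnorm_pCons distrib_left)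
qed simp

lemma wnorm_diff_le:
  assumes "\<rho> \<ge> 0"
  shows "wnorm \<rho> (P - Q) \<le> wnorm \<rho> P + wnorm \<rho> Q"
  using wnorm_add_le[OF assms, of P "- Q"] by (simp add: wnorm_minus)

lemma wnorm_sum_le:
  assumes "\<rho> \<ge> 0"
  shows "wnorm \<rho> (\<Sum>i\<in>I. f i) \<le> (\<Sum>i\<in>I. wnorm \<rho> (f i))"
proof (induction I rule: infinite_finite_induct)
  case (insert i I)
  then show ?case using wnorm_add_le[OF assms, of "f i" "\<Sum>i\<in>I. f i"] by simp
qed auto

lemma wnorm_mult_le:
  assumes "\<rho> \<ge> 0"
  shows "wnorm \<rho> (P * Q) \<le> wnorm \<rho> P * wnorm \<rho> Q"
proof (induction P)
  case (pCons a P)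
  have "wnorm \<rho> (pCons a P * Q) \<le> wnorm \<rho> (smult a Q) + wnorm \<rho> (pCons 0 (P * Q))"
    unfolding mult_pCons_left by (rule wnorm_add_le[OF assms])
  also have "\<dots> = \<bar>a\<bar> * wnorm \<rho> Q + \<rho> * wnorm \<rho> (P * Q)"
    by (simp add: wnorm_smult wnorm_pCons)
  also have "\<dots> \<le> \<bar>a\<bar> * wnorm \<rho> Q + \<rho> * (wnorm \<rho> P * wnorm \<rho> Q)"
    using mult_left_mono[OF pCons(2) assms] by simp
  also have "\<dots> = wnorm \<rho> (pCons a P) * wnorm \<rho> Q"
    by (simp add: wnorm_pCons algebra_simps)
  finally show ?case .
qed simp

lemma coeff_le_wnorm:
  assumes "\<rho> \<ge> 0"
  shows "\<bar>coeff P n\<bar> * \<rho> ^ n \<le> wnorm \<rho> P"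
proof -
  have "\<bar>coeff P n\<bar> * \<rho> ^ n \<le> (\<Sum>i\<le>max n (degree P). \<bar>coeff P i\<bar> * \<rho> ^ i)"
    by (rule member_le_sum) (use assms in auto)
  then show ?thesis using wnorm_eq_sum[of P "max n (degree P)"] by simp
qed

text \<open>
  The same real polynomial has to be evaluated at \<open>cos (2 \<pi> x)\<close> for real and for complex \<open>x\<close>.
\<close>
abbreviation scalar_poly :: "real poly \<Rightarrow> 'a :: {real_normed_field, banach} poly" where
  "scalar_poly \<equiv> map_poly of_real"

lemma scalar_poly_add: "scalar_poly (P + Q) = scalar_poly P + scalar_poly Q"
  by (rule poly_eqI) (simp add: coeff_map_poly)

lemma scalar_poly_smult: "scalar_poly (smult a P) = smult (of_real a) (scalar_poly P)"
  by (rule poly_eqI) (simp add: coeff_map_poly)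

lemma scalar_poly_pCons: "scalar_poly (pCons a P) = pCons (of_real a) (scalar_poly P)"
  by (rule poly_eqI) (simp add: coeff_map_poly coeff_pCons split: nat.split)

lemma scalar_poly_mult: "scalar_poly (P * Q) = scalar_poly P * scalar_poly Q"
  by (induction P) (simp_all add: scalar_poly_add scalar_poly_smult scalar_poly_pCons)

lemma scalar_poly_power: "scalar_poly (P ^ n) = scalar_poly P ^ n"
  by (induction n) (simp_all add: scalar_poly_mult)

lemma scalar_poly_sum: "scalar_poly (\<Sum>i\<in>I. f i) = (\<Sum>i\<in>I. scalar_poly (f i))"
  by (induction I rule: infinite_finite_induct) (simp_all add: scalar_poly_add)

lemma scalar_poly_real [simp]: "(scalar_poly P :: real poly) = P"
  by (simp add: of_real_def)

lemma norm_poly_le_wnorm: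
  assumes "norm u \<le> \<rho>"
  shows "norm (poly (scalar_poly P) u) \<le> wnorm \<rho> P"
proof (induction P)
  case (pCons a P)
  have "norm (poly (scalar_poly (pCons a P)) u) \<le> \<bar>a\<bar> + norm u * norm (poly (scalar_poly P) u)"
    unfolding scalar_poly_pCons poly_pCons
    by (rule order.trans[OF norm_triangle_ineq]) (simp add: norm_mult)
  also have "norm u * norm (poly (scalar_poly P) u) \<le> \<rho> * wnorm \<rho> P"
    using assms pCons(2) by (intro mult_mono order.trans[OF norm_ge_zero assms]) auto
  finally show ?case by (simp add: wnorm_pCons)
qed simp

text \<open>
  These express \<open>cos (2 n \<pi> x)\<close> through \<open>cos (2 \<pi> x)\<close>; their norm grows only geometrically in \<open>n\<close>,
  which is what makes the perturbing potentials \<open>V\<^sub>k\<close> geometrically bounded multiplication operators.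
\<close>
fun chebyshev_T :: "nat \<Rightarrow> real poly" where
  "chebyshev_T 0 = 1"
| "chebyshev_T (Suc 0) = [:0, 1:]"
| "chebyshev_T (Suc (Suc n)) = [:0, 2:] * chebyshev_T (Suc n) - chebyshev_T n"

lemma poly_chebyshev_T: "poly (chebyshev_T n) (cos t) = cos (real n * t)"
proof (induction n rule: chebyshev_T.induct)
  case (3 n)
  have "cos (real (Suc (Suc n)) * t) + cos (real n * t) = 2 * cos t * cos (real (Suc n) * t)"
    by (simp add: cos_plus_cos algebra_simps add_divide_distrib)
  then show ?case using 3 by (simp add: algebra_simps)
qed auto

lemma wnorm_chebyshev_T:
  assumes "\<rho> \<ge> 1"
  shows "wnorm \<rho> (chebyshev_T n) \<le> (2 * \<rho> + 1) ^ n"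
proof (induction n rule: chebyshev_T.induct)
  case (3 n)
  have "wnorm \<rho> (chebyshev_T (Suc (Suc n))) \<le> wnorm \<rho> ([:0, 2:] * chebyshev_T (Suc n)) + wnorm \<rho> (chebyshev_T n)"
    unfolding chebyshev_T.simps by (rule wnorm_diff_le) (use assms in simp)
  also have "\<dots> \<le> wnorm \<rho> [:0, 2:] * wnorm \<rho> (chebyshev_T (Suc n)) + wnorm \<rho> (chebyshev_T n)"
    by (intro add_right_mono wnorm_mult_le) (use assms in simp)
  also have "\<dots> \<le> (2 * \<rho>) * (2 * \<rho> + 1) ^ Suc n + (2 * \<rho> + 1) ^ n"
    using 3 assms by (intro add_mono mult_mono) (auto simp: wnorm_pCons intro: wnorm_nonneg)
  also have "\<dots> \<le> (2 * \<rho>) * (2 * \<rho> + 1) ^ Suc n + (2 * \<rho> + 1) ^ Suc n"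
    using assms by (intro add_left_mono power_increasing) auto
  also have "\<dots> = (2 * \<rho> + 1) ^ Suc (Suc n)"
    by (simp add: algebra_simps)
  finally show ?case .
qed (use assms in \<open>auto simp: wnorm_pCons one_pCons\<close>)

section \<open>A majorant for quadratic recursions\<close>

lemma sum_inverse_squares_le:
  assumes "k \<ge> 1"
  shows "(\<Sum>j=1..k. 1 / (real j)\<^sup>2) \<le> 2 - 1 / real k"
  using assms
proof (induction k rule: dec_induct)
  case (step k)
  have "1 / (real (Suc k))\<^sup>2 \<le> 1 / (real k * real (Suc k))"
    using step(1) by (intro divide_left_mono) (auto simp: power2_eq_square)
  also have "\<dots> = 1 / real k - 1 / real (Suc k)"
    using step(1) by (simp add: field_simps)
  finally show ?case using step by simp
qed simp

text \<open>
  From \<open>1 / (j i) = (1 / j + 1 / i) / (j + i)\<close>: the sequence \<open>1 / k\<^sup>2\<close> reproduces itself under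
  convolution up to a constant factor, so it can serve as a supersolution of a quadratic recursion.
\<close>
lemma sum_inverse_squares_convolution:
  assumes "k \<ge> 1"
  shows "(\<Sum>j=1..<k. 1 / (real j)\<^sup>2 * (1 / (real (k - j))\<^sup>2)) \<le> 8 / (real k)\<^sup>2"
proof -
  have bound: "(\<Sum>j=1..<k. 1 / (real j)\<^sup>2) \<le> 2"
  proof -
    have "(\<Sum>j=1..<k. 1 / (real j)\<^sup>2) \<le> (\<Sum>j=1..k. 1 / (real j)\<^sup>2)"
      by (intro sum_mono2) auto
    also have "\<dots> \<le> 2"
      using sum_inverse_squares_le[OF assms] by (simp add: order.trans)
    finally show ?thesis .
  qed
  have rev: "(\<Sum>j=1..<k. 1 / (real (k - j))\<^sup>2) = (\<Sum>j=1..<k. 1 / (real j)\<^sup>2)"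
    by (rule sum.reindex_bij_witness[of _ "\<lambda>j. k - j" "\<lambda>j. k - j"]) auto
  have "(\<Sum>j=1..<k. 1 / (real j)\<^sup>2 * (1 / (real (k - j))\<^sup>2)) \<le>
      (\<Sum>j=1..<k. 2 / (real k)\<^sup>2 * (1 / (real j)\<^sup>2 + 1 / (real (k - j))\<^sup>2))"
  proof (rule sum_mono)
    fix j assume "j \<in> {1..<k}"
    then obtain i where k: "k = j + i" "i > 0" "j > 0"
      by (auto dest: less_imp_add_positive)
    define u v where "u = 1 / real j" and "v = 1 / real i"
    have "u + v = u * v * real k"
      using k by (simp add: u_def v_def field_simps)
    then have "u * v = (u + v) / real k"
      using k by simp
    then have "(u * v)\<^sup>2 = (u + v)\<^sup>2 / (real k)\<^sup>2"
      by (simp add: power_divide)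
    also have "\<dots> \<le> (2 * (u\<^sup>2 + v\<^sup>2)) / (real k)\<^sup>2"
      using sum_squares_bound[of u v]
      by (intro divide_right_mono) (auto simp: power2_eq_square algebra_simps)
    finally show "1 / (real j)\<^sup>2 * (1 / (real (k - j))\<^sup>2) \<le>
        2 / (real k)\<^sup>2 * (1 / (real j)\<^sup>2 + 1 / (real (k - j))\<^sup>2)"
      using k by (simp add: u_def v_def power_mult_distrib power_divide)
  qed
  also have "\<dots> = 2 / (real k)\<^sup>2 * (2 * (\<Sum>j=1..<k. 1 / (real j)\<^sup>2))"
    unfolding sum_distrib_left[symmetric] sum.distrib rev by simp
  also have "\<dots> \<le> 2 / (real k)\<^sup>2 * (2 * 2)"
    using bound by (intro mult_left_mono) auto
  finally show ?thesis by simp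
qed

lemma square_le_four_power: "(real k)\<^sup>2 \<le> 4 ^ k"
proof -
  have "real k \<le> 2 ^ k" using of_nat_less_two_power[of k, where 'a = real] by simp
  then have "(real k)\<^sup>2 \<le> (2 ^ k)\<^sup>2" by (intro power_mono) auto
  also have "\<dots> = (4::real) ^ k" by (simp add: power_mult flip: power_even_eq)
  finally show ?thesis .
qed

text \<open>
  The inductive claim is \<open>y k \<le> d R\<^sup>k / k\<^sup>2\<close>. With \<open>d\<close> small, the quadratic term uses up at most half of
  this bound, since it is of order \<open>d\<^sup>2\<close>; with \<open>R\<close> large, the forcing term \<open>C A\<^sup>k\<close> fits into the other
  half.
\<close>
lemma quadratic_majorant:
  fixes y :: "nat \<Rightarrow> real"
  assumes nonneg: "\<And>k. y k \<ge> 0" and A: "A > 0" and C: "C \<ge> 1"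
    and rec: "\<And>k. k \<ge> 1 \<Longrightarrow> y k \<le> C * (\<Sum>j=1..<k. y j * y (k - j)) + C * A ^ k"
  shows "\<exists>R>0. \<forall>k\<ge>1. y k \<le> R ^ k"
proof -
  define d where "d = 1 / (16 * C)"
  define R where "R = 128 * C\<^sup>2 * A"
  have d: "d > 0" "d \<le> 1" "C * 8 * d\<^sup>2 = d / 2"
    using C by (auto simp: d_def field_simps power2_eq_square)
  have R: "R > 0" using A C by (simp add: R_def)
  have forcing: "C * A ^ k \<le> d * (R ^ k / (real k)\<^sup>2) / 2" if "k \<ge> 1" for k
  proof -
    have "C\<^sup>2 * 32 * (real k)\<^sup>2 \<le> (C\<^sup>2) ^ k * 32 ^ k * 4 ^ k"
    proof (intro mult_mono)
      show "C\<^sup>2 \<le> (C\<^sup>2) ^ k" using C that by (intro self_le_power) auto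
      show "32 \<le> (32::real) ^ k" using that by (intro self_le_power) auto
      show "(real k)\<^sup>2 \<le> 4 ^ k" by (rule square_le_four_power)
    qed (use C in auto)
    also have "\<dots> = (C\<^sup>2 * 32 * 4) ^ k" by (simp only: power_mult_distrib)
    also have "C\<^sup>2 * 32 * 4 = 128 * C\<^sup>2" by simp
    finally have "C\<^sup>2 * 32 * (real k)\<^sup>2 * A ^ k \<le> R ^ k"
      using A by (simp add: R_def power_mult_distrib[of _ A])
    then show ?thesis
      using C that by (simp add: d_def field_simps power2_eq_square)
  qed
  have "y k \<le> d * (R ^ k / (real k)\<^sup>2)" if "k \<ge> 1" for k
    using that
  proof (induction k rule: less_induct)
    case (less k)
    have "(\<Sum>j=1..<k. y j * y (k - j)) \<le>
        (\<Sum>j=1..<k. d * (R ^ j / (real j)\<^sup>2) * (d * (R ^ (k - j) / (real (k - j))\<^sup>2)))"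
      by (intro sum_mono mult_mono less.IH nonneg)
        (use d R in \<open>auto intro!: mult_nonneg_nonneg divide_nonneg_nonneg\<close>)
    also have "\<dots> = d\<^sup>2 * R ^ k * (\<Sum>j=1..<k. 1 / (real j)\<^sup>2 * (1 / (real (k - j))\<^sup>2))"
      unfolding sum_distrib_left
    proof (rule sum.cong[OF refl])
      fix j assume "j \<in> {1..<k}"
      then have "R ^ k = R ^ j * R ^ (k - j)" by (simp flip: power_add)
      then show "d * (R ^ j / (real j)\<^sup>2) * (d * (R ^ (k - j) / (real (k - j))\<^sup>2)) =
          d\<^sup>2 * R ^ k * (1 / (real j)\<^sup>2 * (1 / (real (k - j))\<^sup>2))"
        by (simp add: power2_eq_square)
    qed
    also have "\<dots> \<le> d\<^sup>2 * R ^ k * (8 / (real k)\<^sup>2)"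
      using sum_inverse_squares_convolution[OF less.prems] R by (intro mult_left_mono) auto
    finally have "C * (\<Sum>j=1..<k. y j * y (k - j)) \<le> C * (d\<^sup>2 * R ^ k * (8 / (real k)\<^sup>2))"
      using C by (intro mult_left_mono) auto
    also have "\<dots> = (C * 8 * d\<^sup>2) * (R ^ k / (real k)\<^sup>2)"
      by simp
    also have "\<dots> = d * (R ^ k / (real k)\<^sup>2) / 2"
      unfolding d(3) by simp
    finally show ?case
      using rec[OF less.prems] forcing[OF less.prems] by linarith
  qed
  moreover have "d * (R ^ k / (real k)\<^sup>2) \<le> R ^ k" if "k \<ge> 1" for k
  proof -
    have "d * (R ^ k / (real k)\<^sup>2) \<le> 1 * (R ^ k / 1)"
      using d R that by (intro mult_mono divide_left_mono) auto
    then show ?thesis by simp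
  qed
  ultimately show ?thesis using R by (intro exI[of _ R]) (auto intro: order.trans)
qed

section \<open>The unperturbed operator on polynomials and its reduced resolvent\<close>

text \<open>
  The operator \<open>\<Phi>\<^sup>-\<^sup>1 H\<^sub>T \<Phi>\<close>, written in the variable \<open>u = cos (2 \<pi> x)\<close>; see \<open>H_T_gauged\<close>.
\<close>
definition gauged_HT :: "nat \<Rightarrow> nat \<Rightarrow> real poly \<Rightarrow> real poly" where
  "gauged_HT l0 l1 P =
     smult (pi\<^sup>2 * (real l0 + real l1 + 2)\<^sup>2) P
     + smult (4 * pi\<^sup>2) ([:real l0 - real l1, real l0 + real l1 + 3:] * pderiv P)
     - smult (4 * pi\<^sup>2) ([:1, 0, -1:] * pderiv (pderiv P))"

text \<open>
  On monomials the operator is upper triangular, with the eigenvalues \<open>E\<^sub>n\<close> on the diagonal and two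
  lowering terms whose coefficients are linear and quadratic in \<open>n\<close>.
\<close>
lemma coeff_gauged_HT:
  "coeff (gauged_HT l0 l1 P) n =
     E_eig l0 l1 n * coeff P n
     + 4 * pi\<^sup>2 * (real l0 - real l1) * real (n + 1) * coeff P (n + 1)
     - 4 * pi\<^sup>2 * real (n + 1) * real (n + 2) * coeff P (n + 2)"
proof -
  have 1: "coeff ([:c, d:] * Q) n = c * coeff Q n + (if n = 0 then 0 else d * coeff Q (n - 1))"
    for c d :: real and Q
    by (cases n) auto
  have 2: "coeff ([:1, 0, -1:] * Q) n = coeff Q n - (if n < 2 then 0 else coeff Q (n - 2))"
    for Q :: "real poly"
    by (cases n; cases "n - 1") auto
  consider "n = 0" | "n = 1" | j where "n = Suc (Suc j)"
    by (metis One_nat_def not0_implies_Suc)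
  then show ?thesis
    unfolding gauged_HT_def coeff_add coeff_diff coeff_smult 1 2 coeff_pderiv
    by cases (auto simp: E_eig_def power2_eq_square algebra_simps)
qed

text \<open>
  \<open>E\<^sub>n - E\<^sub>m\<close> is \<open>4 \<pi>\<^sup>2 (n - m) (n + m + l\<^sub>0 + l\<^sub>1 + 2)\<close>. It grows quadratically in \<open>n\<close>, hence as
  fast as the coefficients of the lowering terms.
\<close>
lemma E_eig_gap:
  assumes "n \<noteq> m"
  shows "\<bar>E_eig l0 l1 n - E_eig l0 l1 m\<bar> * real (m + 3) \<ge> 4 * pi\<^sup>2 * (real (n + 2))\<^sup>2"
proof -
  have eq: "E_eig l0 l1 n - E_eig l0 l1 m =
      4 * pi\<^sup>2 * ((real n - real m) * (real n + real m + real l0 + real l1 + 2))"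
    by (simp add: E_eig_def power2_eq_square algebra_simps)
  have dist: "real (n + 2) \<le> \<bar>real n - real m\<bar> * real (m + 3)"
  proof (cases "n < m")
    case True
    have "real (n + 2) \<le> 1 * real (m + 3)" using True by simp
    also have "\<dots> \<le> \<bar>real n - real m\<bar> * real (m + 3)"
      using True by (intro mult_right_mono) auto
    finally show ?thesis .
  next
    case False
    with assms obtain d where "n = Suc (m + d)"
      using less_imp_Suc_add[of m n] by auto
    then show ?thesis by (simp add: algebra_simps)
  qed
  have "4 * pi\<^sup>2 * (real (n + 2))\<^sup>2 = 4 * pi\<^sup>2 * (real (n + 2) * real (n + 2))"
    by (simp add: power2_eq_square)
  also have "\<dots> \<le> 4 * pi\<^sup>2 * ((\<bar>real n - real m\<bar> * real (m + 3)) *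
      (real n + real m + real l0 + real l1 + 2))"
    using dist by (intro mult_left_mono mult_mono) auto
  also have "\<dots> = \<bar>E_eig l0 l1 n - E_eig l0 l1 m\<bar> * real (m + 3)"
    unfolding eq by (simp add: abs_mult)
  finally show ?thesis .
qed

text \<open>
  Each shifted sum is at most the sum of \<open>x\<close> itself, so that half of the left-hand side reappears on
  the right and can be absorbed.
\<close>
lemma sum_absorb_shifts:
  fixes x g :: "nat \<Rightarrow> real"
  assumes "\<And>n. x n \<ge> 0" "\<And>n. n > d \<Longrightarrow> x n = 0"
    and "\<And>n. n \<ge> a \<Longrightarrow> x n \<le> g n + x (n + 1) / 4 + x (n + 2) / 4"
  shows "(\<Sum>n=a..d. x n) \<le> 2 * (\<Sum>n=a..d. g n)"
proof -
  have shift: "(\<Sum>n=a..d. x (n + i)) \<le> (\<Sum>n=a..d. x n)" for i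
  proof -
    have "(\<Sum>n=a..d. x (n + i)) = (\<Sum>n=a+i..d+i. x n)"
      by (rule sum.shift_bounds_cl_nat_ivl[symmetric])
    also have "\<dots> \<le> (\<Sum>n=a..d+i. x n)"
      using assms(1) by (intro sum_mono2) auto
    also have "\<dots> = (\<Sum>n=a..d. x n)"
      using assms(2) by (intro sum.mono_neutral_right) auto
    finally show ?thesis .
  qed
  have "(\<Sum>n=a..d. x n) \<le> (\<Sum>n=a..d. g n + x (n + 1) / 4 + x (n + 2) / 4)"
    using assms(3) by (intro sum_mono) auto
  also have "\<dots> = (\<Sum>n=a..d. g n) + (\<Sum>n=a..d. x (n + 1)) / 4 + (\<Sum>n=a..d. x (n + 2)) / 4"
    by (simp add: sum.distrib flip: sum_divide_distrib)
  finally show ?thesis using shift[of 1] shift[of 2] by linarith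
qed

text \<open>
  The coefficient equations at \<open>n \<noteq> m\<close> are divided by \<open>E\<^sub>n - E\<^sub>m\<close>. By the quadratic gap the lowering
  terms then have bounded coefficients, and the weight \<open>\<rho>\<close> makes them small enough to be absorbed.
  The unknown \<open>e\<close> does not enter above degree \<open>m\<close>, because \<open>\<psi>\<close> has degree \<open>m\<close>; this bounds the
  coefficients of \<open>R\<close> there. The equation at \<open>n = m\<close>, where \<open>\<psi>\<close> is monic and \<open>R\<close> has no
  coefficient, then bounds \<open>e\<close>, and with \<open>e\<close> known to be bounded the absorption is repeated for all
  degrees. The constant depends neither on \<open>F\<close> nor on the degree of \<open>R\<close>.
\<close>
lemma reduced_resolvent_bound:
  fixes \<psi> :: "real poly"
  assumes \<psi>: "degree \<psi> = m" "lead_coeff \<psi> = 1"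
    and \<rho>: "\<rho> \<ge> 4 * (real (m + 3) * (real l0 + real l1 + 1))"
  shows "\<exists>C. \<forall>R F e. coeff R m = 0 \<and>
      gauged_HT l0 l1 R - smult (E_eig l0 l1 m) R = smult e \<psi> + F \<longrightarrow>
      \<bar>e\<bar> \<le> C * wnorm \<rho> F \<and> wnorm \<rho> R \<le> C * wnorm \<rho> F"
proof -
  define K where "K = real (m + 3) * (real l0 + real l1 + 1)"
  define G where "G = 4 * pi\<^sup>2 * (real l0 + real l1 + 1) * (real (m + 2))\<^sup>2"
  define C1 where "C1 = 1 + 4 * K * G"
  define C2 where "C2 = 2 * K * (1 + C1 * wnorm \<rho> \<psi>)"
  have "1 * 1 \<le> real (m + 3) * (real l0 + real l1 + 1)" by (intro mult_mono) auto
  then have K1: "K \<ge> 1" by (simp add: K_def)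
  have \<rho>K: "\<rho> \<ge> 4 * K" using \<rho> by (simp add: K_def)
  have \<rho>1: "\<rho> \<ge> 1" using \<rho>K K1 by simp
  have G: "G \<ge> 0" by (simp add: G_def)
  have main: "\<bar>e\<bar> \<le> C1 * wnorm \<rho> F \<and> wnorm \<rho> R \<le> C2 * wnorm \<rho> F"
    if Rm: "coeff R m = 0"
      and eq: "gauged_HT l0 l1 R - smult (E_eig l0 l1 m) R = smult e \<psi> + F" for R F e
  proof -
    define r where "r = coeff R"
    define f where "f = coeff F"
    define x where "x n = \<bar>r n\<bar> * \<rho> ^ n" for n
    define d where "d = Max {degree R, degree F, m}"
    have d: "degree R \<le> d" "degree F \<le> d" "m \<le> d" by (auto simp: d_def)
    have x0: "x n \<ge> 0" for n using \<rho>1 by (simp add: x_def)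
    have xd: "x n = 0" if "n > d" for n
      using that d by (simp add: x_def r_def coeff_eq_0)
    have NR: "wnorm \<rho> R = (\<Sum>n=0..d. x n)"
      unfolding x_def r_def by (simp add: wnorm_eq_sum[OF d(1)] atMost_atLeast0)
    have NF: "wnorm \<rho> F = (\<Sum>n=0..d. \<bar>f n\<bar> * \<rho> ^ n)"
      unfolding f_def by (simp add: wnorm_eq_sum[OF d(2)] atMost_atLeast0)
    have N\<psi>: "wnorm \<rho> \<psi> = (\<Sum>n=0..d. \<bar>coeff \<psi> n\<bar> * \<rho> ^ n)"
      using \<psi> d by (simp add: wnorm_eq_sum[of \<psi> d] atMost_atLeast0)
    have NF0: "wnorm \<rho> F \<ge> 0" using \<rho>1 by (intro wnorm_nonneg) simp
    have coeffs: "(E_eig l0 l1 n - E_eig l0 l1 m) * r n = e * coeff \<psi> n + f n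
        - 4 * pi\<^sup>2 * (real l0 - real l1) * real (n + 1) * r (n + 1)
        + 4 * pi\<^sup>2 * real (n + 1) * real (n + 2) * r (n + 2)" for n
      using arg_cong[OF eq, of "\<lambda>P. coeff P n"]
      unfolding coeff_diff coeff_add coeff_smult coeff_gauged_HT r_def f_def
      by (simp add: algebra_simps)
    have lower: "\<bar>4 * pi\<^sup>2 * (real l0 - real l1) * real (n + 1) * r (n + 1)\<bar>
        + \<bar>4 * pi\<^sup>2 * real (n + 1) * real (n + 2) * r (n + 2)\<bar>
        \<le> 4 * pi\<^sup>2 * (real (n + 2))\<^sup>2 * (real l0 + real l1 + 1) * (\<bar>r (n + 1)\<bar> + \<bar>r (n + 2)\<bar>)" for n
    proof -
      have a: "\<bar>real l0 - real l1\<bar> * real (n + 1) \<le> (real l0 + real l1 + 1) * (real (n + 2))\<^sup>2"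
      proof (intro mult_mono)
        have "real (n + 1) \<le> real (n + 2) * 1" by simp
        also have "\<dots> \<le> real (n + 2) * real (n + 2)" by (intro mult_left_mono) auto
        finally show "real (n + 1) \<le> (real (n + 2))\<^sup>2" by (simp add: power2_eq_square)
      qed auto
      have b: "1 * (real (n + 1) * real (n + 2)) \<le> (real l0 + real l1 + 1) * (real (n + 2))\<^sup>2"
        unfolding power2_eq_square by (intro mult_mono) auto
      have "\<bar>4 * pi\<^sup>2 * (real l0 - real l1) * real (n + 1) * r (n + 1)\<bar>
          + \<bar>4 * pi\<^sup>2 * real (n + 1) * real (n + 2) * r (n + 2)\<bar>
          = 4 * pi\<^sup>2 * ((\<bar>real l0 - real l1\<bar> * real (n + 1)) * \<bar>r (n + 1)\<bar>
            + (1 * (real (n + 1) * real (n + 2))) * \<bar>r (n + 2)\<bar>)"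
        unfolding abs_mult abs_of_nat abs_numeral abs_of_nonneg[OF zero_le_power2]
        by (simp add: algebra_simps)
      also have "\<dots> \<le> 4 * pi\<^sup>2 * (((real l0 + real l1 + 1) * (real (n + 2))\<^sup>2) * \<bar>r (n + 1)\<bar>
            + ((real l0 + real l1 + 1) * (real (n + 2))\<^sup>2) * \<bar>r (n + 2)\<bar>)"
        using a b by (intro mult_left_mono add_mono mult_right_mono) auto
      also have "\<dots> = 4 * pi\<^sup>2 * (real (n + 2))\<^sup>2 * (real l0 + real l1 + 1) * (\<bar>r (n + 1)\<bar> + \<bar>r (n + 2)\<bar>)"
        by (simp add: algebra_simps)
      finally show ?thesis .
    qed
    have step: "\<bar>r n\<bar> \<le> K * (\<bar>e * coeff \<psi> n\<bar> + \<bar>f n\<bar>) + K * (\<bar>r (n + 1)\<bar> + \<bar>r (n + 2)\<bar>)" for n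
    proof (cases "n = m")
      case True
      then show ?thesis using Rm K1 by (simp add: r_def)
    next
      case False
      define q where "q = 4 * pi\<^sup>2 * (real (n + 2))\<^sup>2"
      define Lam where "Lam = real l0 + real l1 + 1"
      have pi2: "4 \<le> pi\<^sup>2" using power_mono[OF pi_ge_two, of 2] by simp
      have "1 * 1 \<le> (4 * pi\<^sup>2) * (real (n + 2))\<^sup>2"
        using pi2 by (intro mult_mono one_le_power) auto
      then have q: "q \<ge> 1" by (simp add: q_def)
      have "q * \<bar>r n\<bar> \<le> \<bar>E_eig l0 l1 n - E_eig l0 l1 m\<bar> * real (m + 3) * \<bar>r n\<bar>"
        unfolding q_def by (intro mult_right_mono E_eig_gap False) auto
      also have "\<dots> = real (m + 3) * \<bar>(E_eig l0 l1 n - E_eig l0 l1 m) * r n\<bar>"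
        by (simp add: abs_mult)
      also have "\<dots> \<le> real (m + 3) * (\<bar>e * coeff \<psi> n\<bar> + \<bar>f n\<bar>
          + q * Lam * (\<bar>r (n + 1)\<bar> + \<bar>r (n + 2)\<bar>))"
        unfolding coeffs q_def Lam_def using lower[of n] by (intro mult_left_mono) linarith+
      also have "\<dots> \<le> real (m + 3) * (q * Lam * (\<bar>e * coeff \<psi> n\<bar> + \<bar>f n\<bar>)
          + q * Lam * (\<bar>r (n + 1)\<bar> + \<bar>r (n + 2)\<bar>))"
      proof -
        have "1 * 1 \<le> q * Lam" using q by (intro mult_mono) (auto simp: Lam_def)
        then have "1 * (\<bar>e * coeff \<psi> n\<bar> + \<bar>f n\<bar>) \<le> q * Lam * (\<bar>e * coeff \<psi> n\<bar> + \<bar>f n\<bar>)"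
          by (intro mult_right_mono) auto
        then show ?thesis by (intro mult_left_mono) auto
      qed
      also have "\<dots> = q * (K * (\<bar>e * coeff \<psi> n\<bar> + \<bar>f n\<bar>) + K * (\<bar>r (n + 1)\<bar> + \<bar>r (n + 2)\<bar>))"
        by (simp add: K_def Lam_def algebra_simps)
      finally show ?thesis using q by simp
    qed
    \<comment> \<open>Since \<open>K \<le> \<rho> / 4\<close>, raising the power of \<open>\<rho>\<close> turns the factor \<open>K\<close> into a quarter.\<close>
    have wstep: "x n \<le> K * (\<bar>e\<bar> * (\<bar>coeff \<psi> n\<bar> * \<rho> ^ n) + \<bar>f n\<bar> * \<rho> ^ n) + x (n + 1) / 4 + x (n + 2) / 4" for n
    proof -
      have 4: "K * \<bar>t\<bar> * \<rho> ^ n \<le> \<bar>t\<bar> * \<rho> ^ (n + i) / 4" if "i \<ge> 1" for t i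
      proof -
        have "4 * K * \<rho> ^ n \<le> \<rho> * \<rho> ^ n" using \<rho>K \<rho>1 by (intro mult_right_mono) auto
        also have "\<dots> = \<rho> ^ (n + 1)" by simp
        also have "\<dots> \<le> \<rho> ^ (n + i)" using \<rho>1 that by (intro power_increasing) auto
        finally have "\<bar>t\<bar> * (4 * K * \<rho> ^ n) \<le> \<bar>t\<bar> * \<rho> ^ (n + i)" by (intro mult_left_mono) auto
        then show ?thesis by (simp add: algebra_simps)
      qed
      have "x n \<le> (K * (\<bar>e * coeff \<psi> n\<bar> + \<bar>f n\<bar>) + K * (\<bar>r (n + 1)\<bar> + \<bar>r (n + 2)\<bar>)) * \<rho> ^ n"
        unfolding x_def using step[of n] \<rho>1 by (intro mult_right_mono) auto
      also have "\<dots> = K * (\<bar>e\<bar> * (\<bar>coeff \<psi> n\<bar> * \<rho> ^ n) + \<bar>f n\<bar> * \<rho> ^ n)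
          + K * \<bar>r (n + 1)\<bar> * \<rho> ^ n + K * \<bar>r (n + 2)\<bar> * \<rho> ^ n"
        by (simp add: abs_mult algebra_simps)
      finally show ?thesis
        using 4[of 1 "r (n + 1)"] 4[of 2 "r (n + 2)"] by (simp add: x_def)
    qed
    \<comment> \<open>Above degree \<open>m\<close> only \<open>F\<close> contributes to the right-hand side.\<close>
    have upper: "(\<Sum>n=m+1..d. x n) \<le> 2 * K * wnorm \<rho> F"
    proof -
      have "(\<Sum>n=m+1..d. x n) \<le> 2 * (\<Sum>n=m+1..d. K * (\<bar>f n\<bar> * \<rho> ^ n))"
      proof (rule sum_absorb_shifts[OF x0 xd])
        fix n assume "n \<ge> m + 1"
        then have "coeff \<psi> n = 0" using \<psi> by (intro coeff_eq_0) auto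
        then show "x n \<le> K * (\<bar>f n\<bar> * \<rho> ^ n) + x (n + 1) / 4 + x (n + 2) / 4"
          using wstep[of n] by simp
      qed
      also have "(\<Sum>n=m+1..d. K * (\<bar>f n\<bar> * \<rho> ^ n)) \<le> (\<Sum>n=0..d. K * (\<bar>f n\<bar> * \<rho> ^ n))"
        using K1 \<rho>1 by (intro sum_mono2) auto
      also have "\<dots> = K * wnorm \<rho> F" by (simp add: NF sum_distrib_left)
      finally show ?thesis by simp
    qed
    have e: "\<bar>e\<bar> \<le> C1 * wnorm \<rho> F"
    proof -
      have tail: "\<bar>r n\<bar> \<le> 2 * K * wnorm \<rho> F" if "n > m" for n
      proof -
        have "\<bar>r n\<bar> * 1 \<le> x n" unfolding x_def using \<rho>1 by (intro mult_left_mono) auto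
        also have "x n \<le> (\<Sum>n=m+1..d. x n)"
        proof (cases "n \<le> d")
          case True
          then show ?thesis using that x0 by (intro member_le_sum) auto
        next
          case False
          then show ?thesis using xd x0 by (simp add: sum_nonneg)
        qed
        finally show ?thesis using upper by simp
      qed
      have "\<bar>f m\<bar> * 1 \<le> \<bar>f m\<bar> * \<rho> ^ m" using \<rho>1 by (intro mult_left_mono) auto
      also have "\<dots> \<le> wnorm \<rho> F" unfolding f_def using \<rho>1 by (intro coeff_le_wnorm) auto
      finally have fm: "\<bar>f m\<bar> \<le> wnorm \<rho> F" by simp
      have "\<bar>e\<bar> \<le> \<bar>f m\<bar> + G * (\<bar>r (m + 1)\<bar> + \<bar>r (m + 2)\<bar>)"
        using coeffs[of m] lower[of m] \<psi> unfolding G_def by (simp add: mult_ac)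
      also have "\<dots> \<le> wnorm \<rho> F + G * (2 * K * wnorm \<rho> F + 2 * K * wnorm \<rho> F)"
        using fm tail[of "m + 1"] tail[of "m + 2"] G by (intro add_mono mult_left_mono) auto
      finally show ?thesis by (simp add: C1_def algebra_simps)
    qed
    have "wnorm \<rho> R \<le> 2 * (\<Sum>n=0..d. K * (\<bar>e\<bar> * (\<bar>coeff \<psi> n\<bar> * \<rho> ^ n) + \<bar>f n\<bar> * \<rho> ^ n))"
      unfolding NR by (rule sum_absorb_shifts[OF x0 xd wstep])
    also have "\<dots> = 2 * K * (\<bar>e\<bar> * wnorm \<rho> \<psi> + wnorm \<rho> F)"
      by (simp add: NF N\<psi> sum.distrib flip: sum_distrib_left)
    also have "\<dots> \<le> 2 * K * ((C1 * wnorm \<rho> F) * wnorm \<rho> \<psi> + wnorm \<rho> F)"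
      using e K1 \<rho>1 by (intro mult_left_mono add_mono mult_right_mono wnorm_nonneg) auto
    also have "\<dots> = C2 * wnorm \<rho> F" by (simp add: C2_def algebra_simps)
    finally show ?thesis using e by simp
  qed
  show ?thesis
  proof (intro exI[of _ "max C1 C2"] allI impI)
    fix R F e
    assume "coeff R m = 0 \<and> gauged_HT l0 l1 R - smult (E_eig l0 l1 m) R = smult e \<psi> + F"
    then have "\<bar>e\<bar> \<le> C1 * wnorm \<rho> F \<and> wnorm \<rho> R \<le> C2 * wnorm \<rho> F" using main by blast
    moreover have "C1 * wnorm \<rho> F \<le> max C1 C2 * wnorm \<rho> F" "C2 * wnorm \<rho> F \<le> max C1 C2 * wnorm \<rho> F"
      using \<rho>1 by (auto intro!: mult_right_mono wnorm_nonneg)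
    ultimately show "\<bar>e\<bar> \<le> max C1 C2 * wnorm \<rho> F \<and> wnorm \<rho> R \<le> max C1 C2 * wnorm \<rho> F"
      by linarith
  qed
qed

section \<open>From functions of x to polynomials in cos (2 pi x)\<close>

text \<open>
  Near \<open>x\<close> the logarithmic derivative \<open>g\<close> of \<open>\<Phi>\<close> exists, and \<open>g\<^sup>2 + g'\<close> is the singular potential of
  \<open>H\<^sub>T\<close> minus the constant \<open>\<pi>\<^sup>2 (l\<^sub>0 + l\<^sub>1 + 2)\<^sup>2\<close>; so conjugation by \<open>\<Phi>\<close> cancels the singularities and
  leaves a differential operator with polynomial coefficients in \<open>u = cos (2 \<pi> x)\<close>.
\<close>
lemma H_T_gauged:
  fixes x :: real
  assumes x: "sin (pi * x) \<noteq> 0" "cos (pi * x) \<noteq> 0"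
  shows "H_T l0 l1 (\<lambda>x. Phi l0 l1 x * poly P (cos (2 * pi * x))) x =
         Phi l0 l1 x * poly (gauged_HT l0 l1 P) (cos (2 * pi * x))"
proof -
  define a b where "a = real l0 + 1" and "b = real l1 + 1"
  define u where "u x = cos (2 * pi * x)" for x
  define u' where "u' x = - (2 * pi * sin (2 * pi * x))" for x
  define g where "g x = pi * (a * cos (pi * x) / sin (pi * x) - b * sin (pi * x) / cos (pi * x))" for x
  define f where "f x = (Phi l0 l1 x :: real) * poly P (u x)" for x
  define f' where "f' x = Phi l0 l1 x * (g x * poly P (u x) + poly (pderiv P) (u x) * u' x)" for x
  have Phi_eq: "Phi l0 l1 y = sin (pi * y) ^ Suc l0 * cos (pi * y) ^ Suc l1" for y :: real
    by (simp add: Phi_def)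
  have dPhi: "(Phi l0 l1 has_real_derivative Phi l0 l1 y * g y) (at y)"
    if "sin (pi * y) \<noteq> 0" "cos (pi * y) \<noteq> 0" for y
  proof -
    have 1: "((\<lambda>x. sin (pi * x)) has_real_derivative cos (pi * y) * pi) (at y)"
      and 2: "((\<lambda>x. cos (pi * x)) has_real_derivative - sin (pi * y) * pi) (at y)"
      by (auto intro!: derivative_eq_intros)
    show ?thesis
      unfolding Phi_eq[abs_def] g_def a_def b_def
      by (rule DERIV_cong[OF DERIV_mult[OF DERIV_power_Suc[OF 1] DERIV_power_Suc[OF 2]]])
         (use that in \<open>simp add: field_simps\<close>)
  qed
  have du: "(u has_real_derivative u' y) (at y)" for y
    unfolding u_def u'_def by (auto intro!: derivative_eq_intros)
  have du': "(u' has_real_derivative - (4 * pi\<^sup>2 * u y)) (at y)" for y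
    unfolding u_def u'_def by (auto intro!: derivative_eq_intros simp: power2_eq_square)
  have dP: "((\<lambda>y. poly Q (u y)) has_real_derivative poly (pderiv Q) (u y) * u' y) (at y)" for Q y
    by (rule DERIV_chain2[OF poly_DERIV du])
  have df: "(f has_real_derivative f' y) (at y)"
    if "sin (pi * y) \<noteq> 0" "cos (pi * y) \<noteq> 0" for y
    unfolding f_def[abs_def] f'_def
    by (rule DERIV_cong[OF DERIV_mult[OF dPhi[OF that] dP]]) (simp add: algebra_simps)
  define S where "S = {y :: real. sin (pi * y) \<noteq> 0 \<and> cos (pi * y) \<noteq> 0}"
  have "open S"
    unfolding S_def by (intro open_Collect_conj open_Collect_neq continuous_intros)
  then have ev: "eventually (\<lambda>y. deriv f y = f' y) (nhds x)"
    using x df by (auto simp: S_def eventually_nhds intro!: exI[of _ S] DERIV_imp_deriv)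
  define g' where "g' = - (pi\<^sup>2 * (a / (sin (pi * x))\<^sup>2 + b / (cos (pi * x))\<^sup>2))"
  have dg: "(g has_real_derivative g') (at x)"
  proof -
    define s k where "s = sin (pi * x)" and "k = cos (pi * x)"
    have sk: "s\<^sup>2 + k\<^sup>2 = 1" by (simp add: s_def k_def)
    have "(g has_real_derivative
        pi * (a * ((- s * pi) * s - k * (k * pi)) / (s * s) - b * ((k * pi) * k - s * (- s * pi)) / (k * k))) (at x)"
      unfolding g_def s_def k_def using x
      by (auto intro!: derivative_eq_intros simp: algebra_simps)
    also have "a * ((- s * pi) * s - k * (k * pi)) = - (a * pi * (s\<^sup>2 + k\<^sup>2))"
      by (simp add: power2_eq_square algebra_simps)
    also have "b * ((k * pi) * k - s * (- s * pi)) = b * pi * (s\<^sup>2 + k\<^sup>2)"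
      by (simp add: power2_eq_square algebra_simps)
    finally show ?thesis
      unfolding sk g'_def s_def[symmetric] k_def[symmetric] by (simp add: power2_eq_square algebra_simps)
  qed
  have "deriv (deriv f) x = deriv f' x"
    by (rule deriv_cong_ev[OF ev refl])
  also have "\<dots> = Phi l0 l1 x * (g x * (g x * poly P (u x) + poly (pderiv P) (u x) * u' x)
      + (g' * poly P (u x) + g x * (poly (pderiv P) (u x) * u' x)
      + (poly (pderiv (pderiv P)) (u x) * u' x * u' x - 4 * pi\<^sup>2 * u x * poly (pderiv P) (u x))))"
    unfolding f'_def[abs_def]
    by (rule DERIV_imp_deriv, rule DERIV_cong[OF DERIV_mult[OF dPhi[OF x]
        DERIV_add[OF DERIV_mult[OF dg dP] DERIV_mult[OF dP du']]]]) (simp add: algebra_simps)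
  finally have 1: "deriv (deriv f) x = Phi l0 l1 x * ((g x * g x + g') * poly P (u x)
      + (2 * (g x * u' x) - 4 * pi\<^sup>2 * u x) * poly (pderiv P) (u x)
      + (u' x)\<^sup>2 * poly (pderiv (pderiv P)) (u x))"
    by (simp add: algebra_simps power2_eq_square)
  define s k where "s = sin (pi * x)" and "k = cos (pi * x)"
  have s2: "s\<^sup>2 = 1 - k\<^sup>2" by (simp add: s_def k_def sin_squared_eq)
  have sk0: "s \<noteq> 0" "k \<noteq> 0" using x by (simp_all add: s_def k_def)
  have double: "2 * pi * x = 2 * (pi * x)" by simp
  have uk: "u x = 2 * k\<^sup>2 - 1" unfolding u_def double cos_double_cos k_def by simp
  have u'k: "u' x = - (4 * pi * s * k)" unfolding u'_def double sin_double k_def s_def by simp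
  have u'2: "(u' x)\<^sup>2 = 4 * pi\<^sup>2 * (1 - (u x)\<^sup>2)"
  proof -
    have "(u' x)\<^sup>2 = 16 * pi\<^sup>2 * s\<^sup>2 * k\<^sup>2" unfolding u'k by (simp add: power_mult_distrib)
    then show ?thesis unfolding s2 uk by (simp add: algebra_simps power2_eq_square)
  qed
  have gu: "g x * u' x = - (2 * pi\<^sup>2 * ((a - b) + (a + b) * u x))"
  proof -
    have "g x * u' x = - (4 * pi\<^sup>2 * (a * k\<^sup>2 - b * s\<^sup>2))"
      unfolding g_def u'k s_def[symmetric] k_def[symmetric] using sk0
      by (simp add: field_simps power2_eq_square)
    then show ?thesis unfolding s2 uk by (simp add: algebra_simps)
  qed
  have pot: "HT_potential l0 l1 x - (g x * g x + g') = pi\<^sup>2 * (a + b)\<^sup>2"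
  proof -
    have H: "HT_potential l0 l1 x = pi\<^sup>2 * ((a * (a - 1)) / s\<^sup>2 + (b * (b - 1)) / k\<^sup>2)"
      by (simp add: HT_potential_def a_def b_def s_def k_def algebra_simps)
    have g2: "g x * g x = pi\<^sup>2 * (a\<^sup>2 * (k\<^sup>2 / s\<^sup>2) - 2 * a * b + b\<^sup>2 * (s\<^sup>2 / k\<^sup>2))"
      unfolding g_def s_def[symmetric] k_def[symmetric] using sk0
      by (simp add: field_simps power2_eq_square)
    have ks: "k\<^sup>2 / s\<^sup>2 = 1 / s\<^sup>2 - 1" "s\<^sup>2 / k\<^sup>2 = 1 / k\<^sup>2 - 1"
      using sk0 s2 by (simp_all add: field_simps)
    show ?thesis
      unfolding H g2 ks g'_def s_def[symmetric] k_def[symmetric]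
      by (simp add: algebra_simps power2_eq_square diff_divide_distrib)
  qed
  have "H_T l0 l1 f x = Phi l0 l1 x * ((HT_potential l0 l1 x - (g x * g x + g')) * poly P (u x)
      - (2 * (g x * u' x) - 4 * pi\<^sup>2 * u x) * poly (pderiv P) (u x)
      - (u' x)\<^sup>2 * poly (pderiv (pderiv P)) (u x))"
    unfolding H_T_def 1 by (simp add: f_def algebra_simps)
  also have "\<dots> = Phi l0 l1 x * poly (gauged_HT l0 l1 P) (u x)"
    unfolding pot gu u'2 gauged_HT_def
    by (simp add: a_def b_def algebra_simps power2_eq_square)
  finally show ?thesis by (simp add: f_def[abs_def] u_def)
qed

lemma gauged_HT_diff: "gauged_HT l0 l1 (P - Q) = gauged_HT l0 l1 P - gauged_HT l0 l1 Q"
  by (rule poly_eqI) (simp add: coeff_gauged_HT algebra_simps)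

lemma gauged_HT_smult: "gauged_HT l0 l1 (smult t P) = smult t (gauged_HT l0 l1 P)"
  by (rule poly_eqI) (simp add: coeff_gauged_HT algebra_simps)

definition V_poly :: "nat \<Rightarrow> nat \<Rightarrow> nat \<Rightarrow> real poly" where
  "V_poly l0 l1 k = smult (- 8 * pi\<^sup>2) (\<Sum>n | n dvd k. smult (real n)
     (smult (real (l0 * (l0 + 1))) (chebyshev_T n - 1) +
      smult (real (l1 * (l1 + 1))) (smult ((-1) ^ n) (chebyshev_T n) - 1)))"

lemma poly_V_poly: "poly (V_poly l0 l1 k) (cos (2 * pi * x)) = V_coeff l0 l1 k x"
proof -
  have 1: "cos (2 * real n * pi * x) = poly (chebyshev_T n) (cos (2 * pi * x))" for n
    by (simp add: poly_chebyshev_T mult_ac)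
  have 2: "cos (2 * real n * pi * (x + 1 / 2)) = (-1) ^ n * poly (chebyshev_T n) (cos (2 * pi * x))" for n
  proof -
    have "2 * real n * pi * (x + 1 / 2) = 2 * real n * pi * x + real n * pi"
      by (simp add: algebra_simps)
    then show ?thesis unfolding 1[symmetric] by (simp add: cos_add mult_ac)
  qed
  show ?thesis
    unfolding V_coeff_def V_poly_def 1 2 by (simp add: poly_sum)
qed

text \<open>
  A divisor sum over \<open>n dvd k\<close> has at most \<open>k\<close> terms, each of norm at most a constant times
  \<open>k (2 \<rho> + 1)\<^sup>k\<close>; the factor \<open>k\<^sup>2\<close> is absorbed by \<open>4\<^sup>k\<close>.
\<close>
lemma wnorm_V_poly:
  assumes "\<rho> \<ge> 1"
  shows "\<exists>W A. W > 0 \<and> A > 0 \<and> (\<forall>k\<ge>1. wnorm \<rho> (V_poly l0 l1 k) \<le> W * A ^ k)"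
proof -
  define L where "L = 2 * \<rho> + 1"
  define q where "q = real (l0 * (l0 + 1)) + real (l1 * (l1 + 1))"
  have L: "L \<ge> 1" using assms by (simp add: L_def)
  have q: "q \<ge> 0" by (simp add: q_def)
  have bound: "wnorm \<rho> (V_poly l0 l1 k) \<le> 16 * pi\<^sup>2 * q * (4 * L) ^ k" if k: "k \<ge> 1" for k
  proof -
    define t where "t n = smult (real n)
     (smult (real (l0 * (l0 + 1))) (chebyshev_T n - 1) +
      smult (real (l1 * (l1 + 1))) (smult ((-1) ^ n) (chebyshev_T n) - 1))" for n
    have t: "wnorm \<rho> (t n) \<le> real k * (q * (2 * L ^ k))" if n: "n \<le> k" for n
    proof -
      have one: "wnorm \<rho> 1 = 1" by (simp add: wnorm_def)
      have Ln: "L ^ n \<le> L ^ k" using L n by (intro power_increasing)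
      have Lk: "1 \<le> L ^ k" using L by (rule one_le_power)
      have chebyshev_T: "wnorm \<rho> (chebyshev_T n) \<le> L ^ n" unfolding L_def by (rule wnorm_chebyshev_T[OF assms])
      have "wnorm \<rho> (chebyshev_T n - 1) \<le> wnorm \<rho> (chebyshev_T n) + wnorm \<rho> 1"
        using assms by (intro wnorm_diff_le) simp
      then have 1: "wnorm \<rho> (chebyshev_T n - 1) \<le> 2 * L ^ k" using one chebyshev_T Ln Lk by linarith
      have "wnorm \<rho> (smult ((-1) ^ n) (chebyshev_T n) - 1) \<le> wnorm \<rho> (smult ((-1) ^ n) (chebyshev_T n)) + wnorm \<rho> 1"
        using assms by (intro wnorm_diff_le) simp
      also have "wnorm \<rho> (smult ((-1) ^ n) (chebyshev_T n)) = wnorm \<rho> (chebyshev_T n)"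
        by (simp add: wnorm_smult power_abs)
      finally have 2: "wnorm \<rho> (smult ((-1) ^ n) (chebyshev_T n) - 1) \<le> 2 * L ^ k" using one chebyshev_T Ln Lk by linarith
      have "wnorm \<rho> (t n) \<le> real n * (real (l0 * (l0 + 1)) * wnorm \<rho> (chebyshev_T n - 1)
          + real (l1 * (l1 + 1)) * wnorm \<rho> (smult ((-1) ^ n) (chebyshev_T n) - 1))"
        unfolding t_def wnorm_smult abs_of_nat
        by (intro mult_left_mono order.trans[OF wnorm_add_le])
           (use assms in \<open>auto simp: wnorm_smult simp del: of_nat_mult of_nat_add\<close>)
      also have "\<dots> \<le> real k * (real (l0 * (l0 + 1)) * (2 * L ^ k) + real (l1 * (l1 + 1)) * (2 * L ^ k))"
        using 1 2 n assms by (intro mult_mono add_mono add_nonneg_nonneg mult_nonneg_nonneg wnorm_nonneg) auto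
      finally show ?thesis by (simp add: q_def algebra_simps)
    qed
    have "wnorm \<rho> (V_poly l0 l1 k) = 8 * pi\<^sup>2 * wnorm \<rho> (\<Sum>n | n dvd k. t n)"
      unfolding V_poly_def t_def wnorm_smult by (simp add: abs_mult)
    also have "\<dots> \<le> 8 * pi\<^sup>2 * (\<Sum>n | n dvd k. wnorm \<rho> (t n))"
      using assms by (intro mult_left_mono wnorm_sum_le) auto
    also have "\<dots> \<le> 8 * pi\<^sup>2 * (\<Sum>n=1..k. real k * (q * (2 * L ^ k)))"
    proof (intro mult_left_mono)
      have "(\<Sum>n | n dvd k. wnorm \<rho> (t n)) \<le> (\<Sum>n | n dvd k. real k * (q * (2 * L ^ k)))"
        using k by (intro sum_mono t) (auto intro: dvd_imp_le)
      also have "\<dots> \<le> (\<Sum>n=1..k. real k * (q * (2 * L ^ k)))"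
        using k q L by (intro sum_mono2) (auto intro: dvd_imp_le Suc_leI dvd_pos_nat)
      finally show "(\<Sum>n | n dvd k. wnorm \<rho> (t n)) \<le> (\<Sum>n=1..k. real k * (q * (2 * L ^ k)))" .
    qed simp
    also have "\<dots> = (real k)\<^sup>2 * (16 * pi\<^sup>2 * q * L ^ k)"
      by (simp add: power2_eq_square)
    also have "\<dots> \<le> 4 ^ k * (16 * pi\<^sup>2 * q * L ^ k)"
    proof (intro mult_right_mono)
      show "(real k)\<^sup>2 \<le> 4 ^ k" by (rule square_le_four_power)
    qed (use q L in simp)
    finally show ?thesis by (simp add: power_mult_distrib mult_ac)
  qed
  show ?thesis
  proof (intro exI conjI allI impI)
    fix k :: nat assume "k \<ge> 1"
    have "16 * pi\<^sup>2 * q * (4 * L) ^ k \<le> (16 * pi\<^sup>2 * q + 1) * (4 * L) ^ k"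
      using L by (intro mult_right_mono) auto
    with bound[OF \<open>k \<ge> 1\<close>] show "wnorm \<rho> (V_poly l0 l1 k) \<le> (16 * pi\<^sup>2 * q + 1) * (4 * L) ^ k"
      by linarith
  next
    show "16 * pi\<^sup>2 * q + 1 > 0" using q by (intro add_nonneg_pos) auto
    show "4 * L > 0" using L by simp
  qed
qed

text \<open>
  The points \<open>cos (2 \<pi> x)\<close> with \<open>x\<close> off the zeros of sine and cosine fill the interval \<open>(-1, 1)\<close>, more
  than a nonzero polynomial can have as roots.
\<close>
lemma poly_eq_0_of_cos:
  fixes P :: "real poly"
  assumes "\<And>x. x \<in> {0..1} \<Longrightarrow> sin (pi * x) \<noteq> 0 \<Longrightarrow> cos (pi * x) \<noteq> 0 \<Longrightarrow>
    poly P (cos (2 * pi * x)) = 0"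
  shows "P = 0"
proof (rule ccontr)
  assume "P \<noteq> 0"
  then have "finite {u. poly P u = 0}" by (rule poly_roots_finite)
  moreover have "{-1<..<1} \<subseteq> {u. poly P u = 0}"
  proof
    fix u :: real assume u: "u \<in> {-1<..<1}"
    define x where "x = arccos u / (2 * pi)"
    have cx: "cos (2 * pi * x) = u" using u by (simp add: x_def)
    have "x \<in> {0..1}"
      using u arccos_lbound[of u] arccos_ubound[of u] by (auto simp: x_def field_simps)
    moreover have "u = 2 * (cos (pi * x))\<^sup>2 - 1" "u = 1 - 2 * (sin (pi * x))\<^sup>2"
      using cx cos_double_cos[of "pi * x"] cos_double_sin[of "pi * x"] by (simp_all add: mult_ac)
    then have "sin (pi * x) \<noteq> 0" "cos (pi * x) \<noteq> 0" using u by auto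
    ultimately show "u \<in> {u. poly P u = 0}" using assms[of x] by (simp add: cx)
  qed
  ultimately have "finite {-1<..<(1::real)}" by (rule finite_subset[rotated])
  then show False using infinite_Ioo[of "-1" "1 :: real"] by simp
qed

definition psi_poly :: "nat \<Rightarrow> nat \<Rightarrow> nat \<Rightarrow> real poly" where
  "psi_poly l0 l1 m = smult (c_tilde l0 l1 m) (\<Sum>n\<le>m.
     smult (pochhammer (- real m) n * pochhammer (real (l0 + l1 + 2 + m)) n /
            (pochhammer ((2 * real l0 + 3) / 2) n * fact n)) ([:1 / 2, - (1 / 2):] ^ n))"

lemma psi_eq_poly:
  "psi l0 l1 m x = poly (scalar_poly (psi_poly l0 l1 m)) (cos (2 * of_real pi * x))"
proof -
  have p: "(of_real (pochhammer a n) :: 'a) = pochhammer (of_real a) n" for a n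
    by (simp add: pochhammer_of_real)
  have lin: "scalar_poly [:1 / 2, - (1 / 2):] = ([:1 / 2, - (1 / 2):] :: 'a poly)"
    by (simp add: scalar_poly_pCons)
  show ?thesis
    unfolding psi_def hyp2F1_terminating psi_poly_def scalar_poly_smult scalar_poly_sum
      scalar_poly_power lin
    by (simp add: poly_sum p diff_divide_distrib)
qed

lemma psi_poly_monic: "degree (psi_poly l0 l1 m) = m" "lead_coeff (psi_poly l0 l1 m) = 1"
proof -
  obtain Q :: "real poly" where Q: "degree Q = m" "lead_coeff Q = 1"
      "\<And>x. psi l0 l1 m x = poly Q (cos (2 * of_real pi * x))"
    using psi_monic[where 'a = real] by metis
  have "psi_poly l0 l1 m - Q = 0"
    by (rule poly_eq_0_of_cos) (use Q(3) psi_eq_poly[of l0 l1 m "_ :: real"] in simp)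
  then have "psi_poly l0 l1 m = Q" by simp
  with Q show "degree (psi_poly l0 l1 m) = m" "lead_coeff (psi_poly l0 l1 m) = 1" by simp_all
qed

definition pert_poly :: "nat \<Rightarrow> nat \<Rightarrow> (nat \<Rightarrow> nat \<Rightarrow> real) \<Rightarrow> nat \<Rightarrow> real poly" where
  "pert_poly l0 l1 c k = (\<Sum>m' | c k m' \<noteq> 0. smult (c k m') (psi_poly l0 l1 m'))"

lemma pert_vec_eq_poly:
  "pert_vec l0 l1 c k x =
     Phi l0 l1 x * poly (scalar_poly (pert_poly l0 l1 c k)) (cos (2 * of_real pi * x))"
  unfolding pert_vec_def pert_poly_def v_eig_def psi_eq_poly
  by (simp add: scalar_poly_sum scalar_poly_smult poly_sum sum_distrib_left mult_ac)

lemma pert_vec_real: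
  "(pert_vec l0 l1 c k :: real \<Rightarrow> real) =
     (\<lambda>x. Phi l0 l1 x * poly (pert_poly l0 l1 c k) (cos (2 * pi * x)))"
  by (rule ext) (simp add: pert_vec_eq_poly)

section \<open>The inner product\<close>

definition weighted_inner :: "nat \<Rightarrow> nat \<Rightarrow> real poly \<Rightarrow> real poly \<Rightarrow> real" where
  "weighted_inner l0 l1 P Q =
     L2_inner (\<lambda>x. Phi l0 l1 x * poly P (cos (2 * pi * x))) (\<lambda>x. Phi l0 l1 x * poly Q (cos (2 * pi * x)))"

lemma continuous_on_Phi: "continuous_on S (Phi l0 l1 :: 'a \<Rightarrow> 'a :: {real_normed_field, banach})"
  unfolding Phi_def by (intro continuous_intros)

lemma continuous_on_Phi_poly:
  "continuous_on S (\<lambda>x. Phi l0 l1 x * poly P (cos (2 * pi * x)) :: real)"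
  by (intro continuous_on_mult[OF continuous_on_Phi] continuous_intros)

lemma weighted_inner_commute: "weighted_inner l0 l1 P Q = weighted_inner l0 l1 Q P"
  by (simp add: weighted_inner_def L2_inner_def mult.commute)

lemma weighted_inner_integrable:
  "(\<lambda>x. (Phi l0 l1 x * poly P (cos (2 * pi * x))) * (Phi l0 l1 x * poly Q (cos (2 * pi * x))) :: real)
     integrable_on {0..1}"
  by (intro integrable_continuous_real continuous_on_mult continuous_on_Phi_poly)

lemma weighted_inner_diff_smult:
  "weighted_inner l0 l1 P (Q - smult t R) = weighted_inner l0 l1 P Q - t * weighted_inner l0 l1 P R"
proof -
  have "((\<lambda>x. (Phi l0 l1 x * poly P (cos (2 * pi * x))) * (Phi l0 l1 x * poly (Q - smult t R) (cos (2 * pi * x))))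
      has_integral (weighted_inner l0 l1 P Q - t * weighted_inner l0 l1 P R)) {0..1}"
    using has_integral_diff[OF integrable_integral[OF weighted_inner_integrable[of l0 l1 P Q]]
      has_integral_mult_right[OF integrable_integral[OF weighted_inner_integrable[of l0 l1 P R]], of t]]
    unfolding weighted_inner_def L2_inner_def
    by (rule has_integral_eq[rotated]) (simp add: algebra_simps)
  then show ?thesis unfolding weighted_inner_def[of _ _ P "Q - smult t R"] L2_inner_def
    by (rule integral_unique)
qed

lemma abs_Phi_le_1: "\<bar>Phi l0 l1 x :: real\<bar> \<le> 1"
  unfolding Phi_def abs_mult power_abs
  by (intro mult_le_one power_le_one) auto

text \<open>
  On the real line \<open>\<bar>\<Phi>\<bar> \<le> 1\<close> and \<open>\<bar>cos (2 \<pi> x)\<bar> \<le> 1 \<le> \<rho>\<close>, so both factors of the integrand are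
  bounded by the norms of the polynomials.
\<close>
lemma abs_weighted_inner_le:
  assumes "\<rho> \<ge> 1"
  shows "\<bar>weighted_inner l0 l1 P Q\<bar> \<le> wnorm \<rho> P * wnorm \<rho> Q"
proof -
  have b: "\<bar>Phi l0 l1 x * poly R (cos (2 * pi * x))\<bar> \<le> 1 * wnorm \<rho> R" for R and x :: real
    unfolding abs_mult
    using norm_poly_le_wnorm[of "cos (2 * pi * x)" \<rho> R] assms abs_cos_le_one[of "2 * pi * x"]
    by (intro mult_mono abs_Phi_le_1) auto
  have "norm (weighted_inner l0 l1 P Q) \<le> integral {0..1} (\<lambda>x :: real. wnorm \<rho> P * wnorm \<rho> Q)"
    unfolding weighted_inner_def L2_inner_def
    using b[of _ P] b[of _ Q] assms
    by (intro integral_norm_bound_integral weighted_inner_integrable)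
       (auto simp: abs_mult intro!: mult_mono wnorm_nonneg)
  then show ?thesis by simp
qed

lemma weighted_inner_pos:
  assumes "P \<noteq> 0"
  shows "weighted_inner l0 l1 P P > 0"
proof -
  define h where "h x = (Phi l0 l1 x * poly P (cos (2 * pi * x)) :: real)" for x
  have c: "continuous_on {0..1} (\<lambda>x. h x * h x)"
    unfolding h_def by (intro continuous_on_mult continuous_on_Phi_poly)
  have "weighted_inner l0 l1 P P = integral {0..1} (\<lambda>x. h x * h x)"
    by (simp add: weighted_inner_def L2_inner_def h_def)
  moreover have "integral {0..1} (\<lambda>x. h x * h x) \<ge> 0"
    by (intro integral_nonneg integrable_continuous_real c) auto
  moreover have "integral {0..1} (\<lambda>x. h x * h x) \<noteq> 0"
  proof
    assume "integral {0..1} (\<lambda>x. h x * h x) = 0"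
    then have z: "h x = 0" if "x \<in> {0..1}" for x
      using integral_eq_0_iff[OF c] that by auto
    have "P = 0"
      by (rule poly_eq_0_of_cos) (use z in \<open>auto simp: h_def Phi_def\<close>)
    with assms show False by simp
  qed
  ultimately show ?thesis by simp
qed

section \<open>Geometric growth of the perturbation series\<close>

text \<open>
  Away from its zeros \<open>\<Phi>\<close> can be cancelled, which turns the eigenvalue equation into an identity of
  polynomials. Its case \<open>k = 0\<close> says that \<open>\<psi>\<^sub>m\<close> is an eigenvector of the conjugated operator.
\<close>
lemma perturbation_series_poly:
  assumes pert: "perturbation_series l0 l1 m Et c"
  defines "P \<equiv> pert_poly l0 l1 c"
  shows "P 0 = psi_poly l0 l1 m"
    and "gauged_HT l0 l1 (P k) - smult (C_T l0 l1) (P k) + (\<Sum>j=1..k. V_poly l0 l1 j * P (k - j)) =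
         (\<Sum>j=0..k. smult (Et j) (P (k - j)))"
    and "k \<ge> 1 \<Longrightarrow> (\<Sum>j=0..k. weighted_inner l0 l1 (P j) (P (k - j))) = 0"
proof -
  have "{m'. c 0 m' \<noteq> 0} = {m}" "c 0 m = 1"
    using pert by (auto simp: perturbation_series_def)
  then show "P 0 = psi_poly l0 l1 m" by (simp add: P_def pert_poly_def)
  show "(\<Sum>j=0..k. weighted_inner l0 l1 (P j) (P (k - j))) = 0" if "k \<ge> 1"
    using pert that by (simp add: perturbation_series_def weighted_inner_def P_def pert_vec_real)
  define D where "D = gauged_HT l0 l1 (P k) - smult (C_T l0 l1) (P k)
    + (\<Sum>j=1..k. V_poly l0 l1 j * P (k - j)) - (\<Sum>j=0..k. smult (Et j) (P (k - j)))"
  have "D = 0"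
  proof (rule poly_eq_0_of_cos)
    fix x :: real assume x: "sin (pi * x) \<noteq> 0" "cos (pi * x) \<noteq> 0"
    have vec: "pert_vec l0 l1 c i x = Phi l0 l1 x * poly (P i) (cos (2 * pi * x))" for i
      by (simp add: pert_vec_real P_def)
    have "H_T l0 l1 (pert_vec l0 l1 c k) x = Phi l0 l1 x * poly (gauged_HT l0 l1 (P k)) (cos (2 * pi * x))"
      unfolding pert_vec_real P_def by (rule H_T_gauged[OF x])
    moreover have "H_T l0 l1 (pert_vec l0 l1 c k) x - C_T l0 l1 * pert_vec l0 l1 c k x +
          (\<Sum>j=1..k. V_coeff l0 l1 j x * pert_vec l0 l1 c (k - j) x) =
        (\<Sum>j=0..k. Et j * pert_vec l0 l1 c (k - j) x)"
      using pert x unfolding perturbation_series_def by blast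
    ultimately have "Phi l0 l1 x * poly D (cos (2 * pi * x)) = 0"
      unfolding vec D_def poly_V_poly[symmetric]
      by (simp add: poly_sum sum_distrib_left algebra_simps)
    moreover have "Phi l0 l1 x \<noteq> 0" using x by (simp add: Phi_def)
    ultimately show "poly D (cos (2 * pi * x)) = 0" by simp
  qed
  then show "gauged_HT l0 l1 (P k) - smult (C_T l0 l1) (P k) + (\<Sum>j=1..k. V_poly l0 l1 j * P (k - j)) =
         (\<Sum>j=0..k. smult (Et j) (P (k - j)))"
    by (simp add: D_def)
qed

text \<open>
  The \<open>k\<close>-th polynomial is \<open>a \<psi> + R\<close>, where \<open>a\<close> is its coefficient at \<open>u\<^sup>m\<close>. The reduced resolvent
  bounds \<open>R\<close> and the \<open>k\<close>-th eigenvalue coefficient by a source term \<open>F\<close> formed from lower orders, and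
  the normalisation then bounds \<open>a\<close>, because it determines the product of \<open>\<psi>\<close> with the whole
  polynomial and \<open>\<psi>\<close> has positive length. All these bounds are quadratic in the lower orders, up to
  geometric terms from the potentials, so \<open>quadratic_majorant\<close> applies. Adding \<open>W A\<^sup>k\<close> to the
  sequence makes the products with the potentials part of the quadratic term.
\<close>
lemma perturbation_series_geometric_bound:
  assumes pert: "perturbation_series l0 l1 m Et c"
    and \<rho>: "\<rho> \<ge> 4 * (real (m + 3) * (real l0 + real l1 + 1))"
  shows "\<exists>D R. R > 0 \<and> (\<forall>k. \<bar>Et k\<bar> \<le> D * R ^ k \<and> wnorm \<rho> (pert_poly l0 l1 c k) \<le> D * R ^ k)"
proof -
  define P where "P = pert_poly l0 l1 c"
  define \<psi> where "\<psi> = psi_poly l0 l1 m"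
  define B where "B = weighted_inner l0 l1"
  define N where "N = wnorm \<rho>"
  note series = perturbation_series_poly[OF pert, folded P_def \<psi>_def B_def]
  have "1 * 1 \<le> real (m + 3) * (real l0 + real l1 + 1)" by (intro mult_mono) auto
  then have \<rho>1: "\<rho> \<ge> 1" using \<rho> by linarith
  have \<psi>: "degree \<psi> = m" "lead_coeff \<psi> = 1"
    unfolding \<psi>_def by (rule psi_poly_monic)+
  have N0: "N Q \<ge> 0" for Q unfolding N_def using \<rho>1 by (intro wnorm_nonneg) simp
  have Et0: "Et 0 = E_eig l0 l1 m - C_T l0 l1"
    using pert by (simp add: perturbation_series_def)
  have eigen: "gauged_HT l0 l1 \<psi> = smult (E_eig l0 l1 m) \<psi>"
    using series(2)[of 0] by (simp add: series(1) Et0 smult_diff_left)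
  define \<eta> where "\<eta> = B \<psi> \<psi>"
  have "\<psi> \<noteq> 0" using \<psi>(2) by auto
  then have \<eta>: "\<eta> > 0" unfolding \<eta>_def B_def by (rule weighted_inner_pos)
  obtain C0 where C0: "\<And>Q F e. coeff Q m = 0 \<Longrightarrow>
      gauged_HT l0 l1 Q - smult (E_eig l0 l1 m) Q = smult e \<psi> + F \<Longrightarrow>
      \<bar>e\<bar> \<le> C0 * N F \<and> N Q \<le> C0 * N F"
    using reduced_resolvent_bound[OF \<psi> \<rho>] unfolding N_def by blast
  define C where "C = max C0 0"
  have C: "C \<ge> 0" by (simp add: C_def)
  obtain W A where WA: "W > 0" "A > 0"
    and V: "\<And>k. k \<ge> 1 \<Longrightarrow> N (V_poly l0 l1 k) \<le> W * A ^ k"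
    using wnorm_V_poly[OF \<rho>1] unfolding N_def by blast
  define y where "y k = max \<bar>Et k\<bar> (N (P k))" for k
  define z where "z k = y k + W * A ^ k" for k
  define S where "S k = (\<Sum>j=1..<k. z j * z (k - j)) + N \<psi> * W * A ^ k" for k
  \<comment> \<open>\<open>C\<close> accounts for \<open>R\<close>, the second summand for \<open>a \<psi>\<close>.\<close>
  define C3 where "C3 = C + (N \<psi> * C + 1) / \<eta> * N \<psi>"
  have y0: "y k \<ge> 0" for k by (simp add: y_def le_max_iff_disj)
  have C3: "C3 \<ge> 0" using C N0 \<eta> by (simp add: C3_def)
  have y_le: "y k \<le> C3 * S k" if k: "k \<ge> 1" for k
  proof -
    define a where "a = coeff (P k) m"
    define R where "R = P k - smult a \<psi>"
    define F where "F = (\<Sum>j=1..<k. smult (Et j) (P (k - j)))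
      - (\<Sum>j=1..<k. V_poly l0 l1 j * P (k - j)) - V_poly l0 l1 k * \<psi>"
    have zz: "y j * y (k - j) + W * A ^ j * y (k - j) \<le> z j * z (k - j)" for j
    proof -
      have "z j * z (k - j) = y j * y (k - j) + W * A ^ j * y (k - j)
          + (y j * (W * A ^ (k - j)) + W * A ^ j * (W * A ^ (k - j)))"
        by (simp add: z_def algebra_simps)
      moreover have "0 \<le> y j * (W * A ^ (k - j)) + W * A ^ j * (W * A ^ (k - j))"
        using WA y0 by (intro add_nonneg_nonneg mult_nonneg_nonneg) auto
      ultimately show ?thesis by linarith
    qed
    have split0: "(\<Sum>j=0..k. f j) = f 0 + (\<Sum>j=1..<k. f j) + f k" for f :: "nat \<Rightarrow> 'a :: comm_monoid_add"
    proof -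
      have "{0..k} = insert 0 (insert k {1..<k})" using k by auto
      then show ?thesis using k by (simp add: ac_simps)
    qed
    have split1: "(\<Sum>j=1..k. f j) = (\<Sum>j=1..<k. f j) + f k" for f :: "nat \<Rightarrow> 'a :: comm_monoid_add"
    proof -
      have "{1..k} = insert k {1..<k}" using k by auto
      then show ?thesis by (simp add: ac_simps)
    qed
    have Rm: "coeff R m = 0" using \<psi> by (simp add: R_def a_def)
    have "gauged_HT l0 l1 (P k) - smult (E_eig l0 l1 m) (P k) = smult (Et k) \<psi> + F"
      using series(2)[of k] unfolding split0 split1 Et0 F_def series(1)[symmetric]
      by (simp add: smult_diff_left algebra_simps)
    then have Req: "gauged_HT l0 l1 R - smult (E_eig l0 l1 m) R = smult (Et k) \<psi> + F"
      by (simp add: R_def gauged_HT_diff gauged_HT_smult eigen smult_diff_right mult.commute)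
    have NF: "N F \<le> S k"
    proof -
      have "N F \<le> N (\<Sum>j=1..<k. smult (Et j) (P (k - j)))
          + N (\<Sum>j=1..<k. V_poly l0 l1 j * P (k - j)) + N (V_poly l0 l1 k * \<psi>)"
        unfolding F_def N_def using \<rho>1
        by (intro order.trans[OF wnorm_diff_le] add_mono order.refl) auto
      also have "\<dots> \<le> (\<Sum>j=1..<k. y j * y (k - j)) + (\<Sum>j=1..<k. W * A ^ j * y (k - j)) + W * A ^ k * N \<psi>"
      proof (intro add_mono)
        show "N (\<Sum>j=1..<k. smult (Et j) (P (k - j))) \<le> (\<Sum>j=1..<k. y j * y (k - j))"
          unfolding N_def
        proof (rule order.trans[OF wnorm_sum_le sum_mono])
          show "\<rho> \<ge> 0" using \<rho>1 by simp
          show "wnorm \<rho> (smult (Et j) (P (k - j))) \<le> y j * y (k - j)" for j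
            unfolding wnorm_smult unfolding N_def[symmetric] using N0 y0 by (intro mult_mono) (auto simp: y_def)
        qed
        have mult: "N (Q1 * Q2) \<le> w1 * w2" if "N Q1 \<le> w1" "N Q2 \<le> w2" for Q1 Q2 w1 w2
        proof -
          have "N (Q1 * Q2) \<le> N Q1 * N Q2" unfolding N_def using \<rho>1 by (intro wnorm_mult_le) simp
          also have "\<dots> \<le> w1 * w2"
            using that N0 order.trans[OF N0 that(1)] by (intro mult_mono) auto
          finally show ?thesis .
        qed
        show "N (V_poly l0 l1 k * \<psi>) \<le> W * A ^ k * N \<psi>"
          using V k by (intro mult) auto
        show "N (\<Sum>j=1..<k. V_poly l0 l1 j * P (k - j)) \<le> (\<Sum>j=1..<k. W * A ^ j * y (k - j))"
        proof -
          have "N (\<Sum>j=1..<k. V_poly l0 l1 j * P (k - j)) \<le> (\<Sum>j=1..<k. N (V_poly l0 l1 j * P (k - j)))"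
            unfolding N_def using \<rho>1 by (intro wnorm_sum_le) simp
          also have "\<dots> \<le> (\<Sum>j=1..<k. W * A ^ j * y (k - j))"
            by (intro sum_mono mult V) (auto simp: y_def)
          finally show ?thesis .
        qed
      qed
      also have "\<dots> = (\<Sum>j=1..<k. y j * y (k - j) + W * A ^ j * y (k - j)) + N \<psi> * W * A ^ k"
        by (simp add: sum.distrib mult_ac)
      also have "\<dots> \<le> S k"
        unfolding S_def using zz by (intro add_right_mono sum_mono) auto
      finally show ?thesis .
    qed
    have "C0 * N F \<le> C * S k"
      using NF N0[of F] by (intro mult_mono) (auto simp: C_def)
    then have E: "\<bar>Et k\<bar> \<le> C * S k" and NR: "N R \<le> C * S k"
      using C0[OF Rm Req] by linarith+
    have S0: "S k \<ge> 0" using NF N0[of F] by linarith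
    have a: "\<bar>a\<bar> \<le> (N \<psi> * C + 1) / \<eta> * S k"
    proof -
      have "B \<psi> R = B \<psi> (P k) - a * \<eta>"
        unfolding B_def R_def \<eta>_def by (rule weighted_inner_diff_smult)
      moreover have "2 * B \<psi> (P k) + (\<Sum>j=1..<k. B (P j) (P (k - j))) = 0"
        using series(3)[OF k] weighted_inner_commute[of l0 l1 "P k" \<psi>]
        unfolding split0 by (simp add: series(1) B_def)
      ultimately have 1: "2 * (a * \<eta>) = - (\<Sum>j=1..<k. B (P j) (P (k - j))) - 2 * B \<psi> R"
        by simp
      have BN: "\<bar>B Q1 Q2\<bar> \<le> N Q1 * N Q2" for Q1 Q2
        unfolding B_def N_def by (rule abs_weighted_inner_le[OF \<rho>1])
      have "\<bar>\<Sum>j=1..<k. B (P j) (P (k - j))\<bar> \<le> (\<Sum>j=1..<k. z j * z (k - j))"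
      proof (intro order.trans[OF sum_abs sum_mono])
        fix j
        have "\<bar>B (P j) (P (k - j))\<bar> \<le> N (P j) * N (P (k - j))" by (rule BN)
        also have "\<dots> \<le> y j * y (k - j)"
          using N0 y0 by (intro mult_mono) (auto simp: y_def)
        also have "\<dots> \<le> z j * z (k - j)"
          using zz[of j] y0[of "k - j"] WA
          by (smt (verit) mult_nonneg_nonneg zero_le_power)
        finally show "\<bar>B (P j) (P (k - j))\<bar> \<le> z j * z (k - j)" .
      qed
      also have "\<dots> \<le> S k"
        unfolding S_def using N0[of \<psi>] WA by simp
      finally have 2: "\<bar>\<Sum>j=1..<k. B (P j) (P (k - j))\<bar> \<le> S k" .
      have "\<bar>B \<psi> R\<bar> \<le> N \<psi> * N R" by (rule BN)
      also have "\<dots> \<le> N \<psi> * (C * S k)" using NR N0 by (intro mult_left_mono)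
      finally have "2 * \<bar>a * \<eta>\<bar> \<le> S k + 2 * (N \<psi> * (C * S k))"
        using 1 2 by linarith
      then have "\<bar>a\<bar> * \<eta> \<le> (N \<psi> * C + 1) * S k"
        using S0 \<eta> by (simp add: abs_mult algebra_simps)
      then show ?thesis using \<eta> by (simp add: field_simps)
    qed
    have "P k = smult a \<psi> + R" by (simp add: R_def)
    then have "N (P k) \<le> N (smult a \<psi>) + N R"
      unfolding N_def using \<rho>1 by (simp add: wnorm_add_le)
    also have "N (smult a \<psi>) = \<bar>a\<bar> * N \<psi>" by (simp add: N_def wnorm_smult)
    also have "\<bar>a\<bar> * N \<psi> + N R \<le> (N \<psi> * C + 1) / \<eta> * S k * N \<psi> + C * S k"
      using a NR N0 by (intro add_mono mult_right_mono)
    also have "\<dots> = C3 * S k" by (simp add: C3_def algebra_simps)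
    finally have "N (P k) \<le> C3 * S k" .
    moreover have "C * S k \<le> C3 * S k"
      using S0 C N0 \<eta> by (intro mult_right_mono) (auto simp: C3_def)
    ultimately show ?thesis using E by (simp add: y_def)
  qed
  define C4 where "C4 = max 1 (max C3 (C3 * N \<psi> * W + W))"
  have "\<exists>R>0. \<forall>k\<ge>1. z k \<le> R ^ k"
  proof (rule quadratic_majorant)
    show "z k \<ge> 0" for k using y0 WA by (simp add: z_def)
    show "A > 0" by (rule WA)
    show "C4 \<ge> 1" by (simp add: C4_def)
    fix k :: nat assume k: "k \<ge> 1"
    have "z k \<le> C3 * S k + W * A ^ k" using y_le[OF k] by (simp add: z_def)
    also have "\<dots> = C3 * (\<Sum>j=1..<k. z j * z (k - j)) + (C3 * N \<psi> * W + W) * A ^ k"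
      by (simp add: S_def algebra_simps)
    also have "\<dots> \<le> C4 * (\<Sum>j=1..<k. z j * z (k - j)) + C4 * A ^ k"
      using y0 WA
      by (intro add_mono mult_right_mono sum_nonneg mult_nonneg_nonneg)
         (auto simp: C4_def z_def)
    finally show "z k \<le> C4 * (\<Sum>j=1..<k. z j * z (k - j)) + C4 * A ^ k" .
  qed
  then obtain R where R: "R > 0" "\<And>k. k \<ge> 1 \<Longrightarrow> z k \<le> R ^ k" by blast
  define D where "D = max 1 (y 0)"
  have "y k \<le> D * R ^ k" for k
  proof (cases "k = 0")
    case False
    have "y k \<le> z k" using WA by (simp add: z_def)
    also have "z k \<le> 1 * R ^ k" using R False by simp
    also have "\<dots> \<le> D * R ^ k" using R by (intro mult_right_mono) (auto simp: D_def)
    finally show ?thesis .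
  qed (simp add: D_def)
  then have "\<forall>k. \<bar>Et k\<bar> \<le> D * R ^ k \<and> N (P k) \<le> D * R ^ k"
    by (simp add: y_def)
  with R(1) show ?thesis unfolding N_def P_def by blast
qed

section \<open>Convergence\<close>

lemma uniformly_convergent_on_power_series:
  fixes f :: "nat \<Rightarrow> 'b \<Rightarrow> complex"
  assumes "\<And>k x. x \<in> K \<Longrightarrow> norm (f k x) \<le> D * R ^ k" and "R > 0" and "norm p < 1 / R"
  shows "uniformly_convergent_on K (\<lambda>N x. \<Sum>k<N. f k x * p ^ k)"
proof (rule Weierstrass_m_test')
  have "R * norm p < 1" using assms(2,3) by (simp add: field_simps)
  then show "summable (\<lambda>k. D * (R * norm p) ^ k)"
    using assms(2) by (intro summable_mult summable_geometric) simp
  fix k x assume "x \<in> K"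
  then have "norm (f k x) * norm p ^ k \<le> D * R ^ k * norm p ^ k"
    using assms(1) by (intro mult_right_mono) auto
  then show "norm (f k x * p ^ k) \<le> D * (R * norm p) ^ k"
    by (simp add: norm_mult norm_power power_mult_distrib mult.assoc)
qed

theorem corollary5p2:
  fixes l0 l1 m :: nat and Et :: "nat \<Rightarrow> real" and c :: "nat \<Rightarrow> nat \<Rightarrow> real"
  assumes "perturbation_series l0 l1 m Et c"
  shows "(\<exists>r>0. \<forall>p::complex. norm p < r \<longrightarrow>
            summable (\<lambda>k. of_real (Et k) * p ^ k) \<and>
            (\<forall>K::real set. compact K \<longrightarrow>
               uniformly_convergent_on K
                 (\<lambda>N x. \<Sum>k<N. of_real (pert_vec l0 l1 c k x) * p ^ k))) \<and>
         (\<forall>K::complex set. compact K \<longrightarrow>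
            (\<exists>r>0. \<forall>p::complex. norm p < r \<longrightarrow>
               uniformly_convergent_on K
                 (\<lambda>N x. \<Sum>k<N. pert_vec l0 l1 c k x * p ^ k)))"
proof -
  define \<rho>0 where "\<rho>0 = 4 * (real (m + 3) * (real l0 + real l1 + 1))"
  have "1 * 1 \<le> real (m + 3) * (real l0 + real l1 + 1)" by (intro mult_mono) auto
  then have \<rho>0: "\<rho>0 \<ge> 1" by (simp add: \<rho>0_def)
  have real_part: "\<exists>r>0. \<forall>p::complex. norm p < r \<longrightarrow>
            summable (\<lambda>k. of_real (Et k) * p ^ k) \<and>
            (\<forall>K::real set. compact K \<longrightarrow>
               uniformly_convergent_on K
                 (\<lambda>N x. \<Sum>k<N. of_real (pert_vec l0 l1 c k x) * p ^ k))"
  proof -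
    obtain D R where R: "R > 0" and E: "\<And>k. \<bar>Et k\<bar> \<le> D * R ^ k"
      and P: "\<And>k. wnorm \<rho>0 (pert_poly l0 l1 c k) \<le> D * R ^ k"
      using perturbation_series_geometric_bound[OF assms, of \<rho>0] unfolding \<rho>0_def by blast
    have vec: "norm (of_real (pert_vec l0 l1 c k x) :: complex) \<le> D * R ^ k" for k and x :: real
    proof -
      have "norm (of_real (pert_vec l0 l1 c k x) :: complex) =
          \<bar>Phi l0 l1 x\<bar> * norm (poly (scalar_poly (pert_poly l0 l1 c k)) (cos (2 * pi * x)))"
        by (simp add: pert_vec_real norm_mult)
      also have "\<dots> \<le> 1 * wnorm \<rho>0 (pert_poly l0 l1 c k)"
        by (intro mult_mono abs_Phi_le_1 norm_poly_le_wnorm)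
           (auto intro: order.trans[OF abs_cos_le_one \<rho>0])
      finally show ?thesis using P[of k] by simp
    qed
    have "summable (\<lambda>k. of_real (Et k) * p ^ k)" if "norm p < 1 / R" for p :: complex
    proof -
      \<comment> \<open>A numerical series is a series of functions on a one-point set.\<close>
      have "uniformly_convergent_on {()} (\<lambda>N x. \<Sum>k<N. of_real (Et k) * p ^ k)"
        using E R that by (intro uniformly_convergent_on_power_series[of _ _ D R]) auto
      then show ?thesis
        by (auto simp: summable_iff_convergent dest: uniformly_convergent_imp_convergent)
    qed
    moreover have "uniformly_convergent_on K (\<lambda>N x. \<Sum>k<N. of_real (pert_vec l0 l1 c k x) * p ^ k)"
      if "norm p < 1 / R" for p :: complex and K :: "real set"
      using vec R that by (rule uniformly_convergent_on_power_series)
    ultimately show ?thesis using R by (intro exI[of _ "1 / R"]) auto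
  qed
  have complex_part: "\<exists>r>0. \<forall>p::complex. norm p < r \<longrightarrow>
               uniformly_convergent_on K
                 (\<lambda>N x. \<Sum>k<N. pert_vec l0 l1 c k x * p ^ k)" if K: "compact K" for K :: "complex set"
  proof -
    have "bounded ((\<lambda>x. cos (2 * of_real pi * x)) ` K)"
      by (intro compact_imp_bounded compact_continuous_image continuous_intros K)
    then obtain M where M: "\<And>x. x \<in> K \<Longrightarrow> norm (cos (2 * of_real pi * x)) \<le> M"
      unfolding bounded_iff by blast
    have "bounded (Phi l0 l1 ` K)"
      by (intro compact_imp_bounded compact_continuous_image continuous_on_Phi K)
    then obtain b where b: "\<And>x. x \<in> K \<Longrightarrow> norm (Phi l0 l1 x) \<le> b"
      unfolding bounded_iff by blast
    \<comment> \<open>The radius of convergence depends on \<open>K\<close>, because \<open>\<rho>\<close> has to dominate \<open>cos (2 \<pi> x)\<close> on \<open>K\<close>.\<close>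
    define \<rho> where "\<rho> = max M \<rho>0"
    have "\<rho> \<ge> 4 * (real (m + 3) * (real l0 + real l1 + 1))" by (simp add: \<rho>_def \<rho>0_def)
    then obtain D R where R: "R > 0" and P: "\<And>k. wnorm \<rho> (pert_poly l0 l1 c k) \<le> D * R ^ k"
      using perturbation_series_geometric_bound[OF assms, of \<rho>] by blast
    have vec: "norm (pert_vec l0 l1 c k x) \<le> (b * D) * R ^ k" if x: "x \<in> K" for k x
    proof -
      have "norm (poly (scalar_poly (pert_poly l0 l1 c k)) (cos (2 * of_real pi * x))) \<le> D * R ^ k"
        using M[OF x] by (intro order.trans[OF norm_poly_le_wnorm P]) (simp add: \<rho>_def)
      then have "norm (pert_vec l0 l1 c k x) \<le> b * (D * R ^ k)"
        unfolding pert_vec_eq_poly norm_mult using b[OF x]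
        by (intro mult_mono) (auto intro: order.trans[OF norm_ge_zero])
      then show ?thesis by simp
    qed
    have "uniformly_convergent_on K (\<lambda>N x. \<Sum>k<N. pert_vec l0 l1 c k x * p ^ k)"
      if "norm p < 1 / R" for p :: complex
      using vec R that by (rule uniformly_convergent_on_power_series)
    then show ?thesis using R by (intro exI[of _ "1 / R"]) auto
  qed
  show ?thesis using real_part complex_part by blast
qed

end
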